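(* For a pair $([\nabla],[g])$ comprising a projective structure $[\nabla]$ and a conformal structure $[g]$ on a manifold $M$ the following are equivalent. (1) $([\nabla],[g])$ is locally statistical in the sense that every $p\in M$ is contained in an open neighborhood $U\subset M$ on which there is a representative $\nabla\in[\nabla]$ (not necessarily aligned with respect to $[g]$) and a representative metric $g\in[g]$ such that $\nabla_{[i}g_{j]k}=0$ on $U$, that is, such that $(\nabla,g)$ is a statistical structure on $U$. (2) For the aligned representative $\nabla\in[\nabla]$, $(\nabla,[g])$ is an AH structure. (3) For any $g\in[g]$ there is $\tilde\nabla\in[\nabla]$ such that $(\tilde\nabla,g)$ is a statistical structure.
   Context: Let $n=\dim M$ ($n\ge2$). A projective structure $[\nabla]$ is an equivalence class of torsion-free affine connections modulo $\nabla\sim\nabla+2\sigma_{(i}\delta_{j)}{}^k$, $\sigma$ a one-form. A conformal structure is a class of pseudo-Riemannian metrics modulo multiplication by positive functions. $[\,]$, $(\,)$ on indices denote antisymmetrization/symmetrization. A statistical structure is a pair $(\nabla,g)$ of a torsion-free affine connection and a pseudo-Riemannian metric with $\nabla_{[i}g_{j]k}=0$. A torsion-free $\nabla$ is aligned with respect to $[g]$ if $g^{pq}\nabla_ig_{pq}=n\,g^{pq}\nabla_pg_{qi}$ for each $g\in[g]$ (independent of the choice of $g$); every projective structure contains a unique representative aligned with respect to a given $[g]$. $(\nabla,[g])$ is an AH structure if $\nabla$ is torsion-free, aligned with respect to $[g]$, and for each $g\in[g]$ there is a one-form $\chi_i$ such that $\nabla_{[i}g_{j]k}=\chi_{[i}g_{j]k}$.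 *)

theory Defs
  imports "HOL-Analysis.Analysis"
begin

section \<open>Smooth functions on open subsets of normed spaces\<close>

text \<open>Only used for open \<open>S\<close>, since the derivatives are full (not one-sided) derivatives.\<close>

fun Ck_on :: "nat \<Rightarrow> 'v::real_normed_vector set \<Rightarrow> ('v \<Rightarrow> 'w::real_normed_vector) \<Rightarrow> bool" where
  "Ck_on 0 S f \<longleftrightarrow> continuous_on S f"
| "Ck_on (Suc k) S f \<longleftrightarrow>
     (\<forall>x\<in>S. f differentiable (at x)) \<and> (\<forall>v. Ck_on k S (\<lambda>x. frechet_derivative f (at x) v))"

definition smooth_on :: "'v::real_normed_vector set \<Rightarrow> ('v \<Rightarrow> 'w::real_normed_vector) \<Rightarrow> bool" where
  "smooth_on S f \<longleftrightarrow> (\<forall>k. Ck_on k S f)"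


section \<open>Smooth manifolds\<close>

text \<open>A chart is a pair of its domain and its coordinate map; values of the coordinate map outside
  the domain are irrelevant. The dimension of the manifold is \<open>CARD('n)\<close>. The atlas is not required
  to be maximal; a smooth structure is determined by any one of its atlases.\<close>

type_synonym ('a, 'n) chart = "'a set \<times> ('a \<Rightarrow> real ^ 'n)"

definition chart_on :: "'a topology \<Rightarrow> ('a, 'n::finite) chart \<Rightarrow> bool" where
  "chart_on M c \<longleftrightarrow> openin M (fst c) \<and> open (snd c ` fst c) \<and>
     homeomorphic_map (subtopology M (fst c)) (top_of_set (snd c ` fst c)) (snd c)"

definition chart_inv :: "('a, 'n::finite) chart \<Rightarrow> real ^ 'n \<Rightarrow> 'a" where
  "chart_inv c = inv_into (fst c) (snd c)"

definition smooth_manifold :: "'a topology \<Rightarrow> ('a, 'n::finite) chart set \<Rightarrow> bool" where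
  "smooth_manifold M A \<longleftrightarrow>
     Hausdorff_space M \<and> second_countable M \<and>
     (\<forall>c\<in>A. chart_on M c) \<and> (\<Union>c\<in>A. fst c) = topspace M \<and>
     (\<forall>c\<in>A. \<forall>d\<in>A. smooth_on (snd c ` (fst c \<inter> fst d)) (snd d \<circ> chart_inv c))"

text \<open>Smoothness, read in the chart \<open>c\<close>, of a function on \<open>U \<inter> fst c\<close>.\<close>

definition smooth_in_chart :: "('a, 'n::finite) chart \<Rightarrow> 'a set \<Rightarrow> ('a \<Rightarrow> real) \<Rightarrow> bool" where
  "smooth_in_chart c U f \<longleftrightarrow> smooth_on (snd c ` (U \<inter> fst c)) (f \<circ> chart_inv c)"

definition smooth_fun :: "('a, 'n::finite) chart set \<Rightarrow> 'a set \<Rightarrow> ('a \<Rightarrow> real) \<Rightarrow> bool" where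
  "smooth_fun A U f \<longleftrightarrow> (\<forall>c\<in>A. smooth_in_chart c U f)"

text \<open>The partial derivative of \<open>f\<close> at \<open>p\<close> with respect to the \<open>i\<close>-th coordinate of \<open>c\<close>.\<close>

definition coord_deriv :: "('a, 'n::finite) chart \<Rightarrow> 'n \<Rightarrow> ('a \<Rightarrow> real) \<Rightarrow> 'a \<Rightarrow> real" where
  "coord_deriv c i f p = frechet_derivative (f \<circ> chart_inv c) (at (snd c p)) (axis i 1)"

text \<open>With \<open>x\<close> the coordinates of \<open>c\<close> and \<open>y\<close> those of \<open>d\<close>: \<open>jac c d a i p\<close> is
  \<open>\<partial>y\<^sup>a/\<partial>x\<^sup>i\<close> at \<open>p\<close>.\<close>

definition jac :: "('a, 'n::finite) chart \<Rightarrow> ('a, 'n) chart \<Rightarrow> 'n \<Rightarrow> 'n \<Rightarrow> 'a \<Rightarrow> real" where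
  "jac c d a i = coord_deriv c i (\<lambda>q. snd d q $ a)"


section \<open>One-forms, metrics, connections\<close>

text \<open>A geometric object on an open set \<open>U\<close> is the family, indexed by the charts of the atlas, of its
  components in these charts (as functions of the point), subject to the transformation law of
  the object. So that an object is determined by its components at the points of \<open>U\<close>, these
  families are \<open>0\<close> where they carry no meaning.\<close>

type_synonym ('a, 'n, 't) field = "('a, 'n) chart \<Rightarrow> 'a \<Rightarrow> 't"
type_synonym ('a, 'n) oneform = "('a, 'n, real ^ 'n) field"
type_synonym ('a, 'n) metric = "('a, 'n, real ^ 'n ^ 'n) field"
type_synonym ('a, 'n) connection = "('a, 'n, real ^ 'n ^ 'n ^ 'n) field"

definition supported_on :: "('a, 'n::finite) chart set \<Rightarrow> 'a set \<Rightarrow> ('a, 'n, 't::zero) field \<Rightarrow> bool" where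
  "supported_on A U T \<longleftrightarrow> (\<forall>c p. \<not> (c \<in> A \<and> p \<in> U \<inter> fst c) \<longrightarrow> T c p = 0)"

definition restrict_field :: "'a set \<Rightarrow> ('a, 'n::finite, 't::zero) field \<Rightarrow> ('a, 'n, 't) field" where
  "restrict_field U T = (\<lambda>c p. if p \<in> U then T c p else 0)"

definition oneform_on :: "('a, 'n::finite) chart set \<Rightarrow> 'a set \<Rightarrow> ('a, 'n) oneform \<Rightarrow> bool" where
  "oneform_on A U \<sigma> \<longleftrightarrow> supported_on A U \<sigma> \<and>
     (\<forall>c\<in>A. \<forall>i. smooth_in_chart c U (\<lambda>p. \<sigma> c p $ i)) \<and>
     (\<forall>c\<in>A. \<forall>d\<in>A. \<forall>p\<in>U \<inter> fst c \<inter> fst d. \<forall>i.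
        \<sigma> c p $ i = (\<Sum>a\<in>UNIV. jac c d a i p * \<sigma> d p $ a))"

text \<open>Pseudo-Riemannian metrics: smooth, symmetric, nondegenerate covariant 2-tensors, of any
  signature.\<close>

definition metric_on :: "('a, 'n::finite) chart set \<Rightarrow> 'a set \<Rightarrow> ('a, 'n) metric \<Rightarrow> bool" where
  "metric_on A U g \<longleftrightarrow> supported_on A U g \<and>
     (\<forall>c\<in>A. \<forall>i j. smooth_in_chart c U (\<lambda>p. g c p $ i $ j)) \<and>
     (\<forall>c\<in>A. \<forall>d\<in>A. \<forall>p\<in>U \<inter> fst c \<inter> fst d. \<forall>i j.
        g c p $ i $ j =
          (\<Sum>a\<in>UNIV. \<Sum>b\<in>UNIV. jac c d a i p * jac c d b j p * g d p $ a $ b)) \<and>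
     (\<forall>c\<in>A. \<forall>p\<in>U \<inter> fst c. transpose (g c p) = g c p \<and> invertible (g c p))"

text \<open>An affine connection is given by its Christoffel symbols: \<open>\<Gamma> c p $ k $ i $ j\<close> is
  \<open>\<Gamma>\<^sub>i\<^sub>j\<^sup>k\<close>, where \<open>\<nabla>\<^bsub>\<partial>\<^sub>i\<^esub> \<partial>\<^sub>j = \<Gamma>\<^sub>i\<^sub>j\<^sup>k \<partial>\<^sub>k\<close>. The transformation law results from expanding
  \<open>\<nabla>\<^bsub>\<partial>\<^sub>i\<^esub> \<partial>\<^sub>j\<close> for the coordinate fields of \<open>c\<close> in terms of those of \<open>d\<close>.\<close>

definition connection_on :: "('a, 'n::finite) chart set \<Rightarrow> 'a set \<Rightarrow> ('a, 'n) connection \<Rightarrow> bool" where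
  "connection_on A U \<Gamma> \<longleftrightarrow> supported_on A U \<Gamma> \<and>
     (\<forall>c\<in>A. \<forall>k i j. smooth_in_chart c U (\<lambda>p. \<Gamma> c p $ k $ i $ j)) \<and>
     (\<forall>c\<in>A. \<forall>d\<in>A. \<forall>p\<in>U \<inter> fst c \<inter> fst d. \<forall>m i j.
        (\<Sum>k\<in>UNIV. jac c d m k p * \<Gamma> c p $ k $ i $ j) =
          (\<Sum>a\<in>UNIV. \<Sum>b\<in>UNIV. jac c d a i p * jac c d b j p * \<Gamma> d p $ m $ a $ b)
          + coord_deriv c i (jac c d m j) p)"

definition torsion_free_connection_on ::
    "('a, 'n::finite) chart set \<Rightarrow> 'a set \<Rightarrow> ('a, 'n) connection \<Rightarrow> bool" where
  "torsion_free_connection_on A U \<Gamma> \<longleftrightarrow> connection_on A U \<Gamma> \<and>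
     (\<forall>c\<in>A. \<forall>p\<in>U \<inter> fst c. \<forall>k i j. \<Gamma> c p $ k $ i $ j = \<Gamma> c p $ k $ j $ i)"


section \<open>Projective and conformal structures\<close>

definition sym2 :: "('n \<Rightarrow> 'n \<Rightarrow> real) \<Rightarrow> 'n \<Rightarrow> 'n \<Rightarrow> real" where
  "sym2 T i j = (T i j + T j i) / 2"

definition alt2 :: "('n \<Rightarrow> 'n \<Rightarrow> real) \<Rightarrow> 'n \<Rightarrow> 'n \<Rightarrow> real" where
  "alt2 T i j = (T i j - T j i) / 2"

text \<open>\<open>\<Gamma>' = \<Gamma> + 2 \<sigma>\<^bsub>(i\<^esub>\<delta>\<^bsub>j)\<^esub>\<^sup>k\<close>\<close>

definition projective_rel ::
    "('a, 'n::finite) chart set \<Rightarrow> 'a set \<Rightarrow> (('a, 'n) connection \<times> ('a, 'n) connection) set" where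
  "projective_rel A U = {(\<Gamma>, \<Gamma>').
     torsion_free_connection_on A U \<Gamma> \<and> torsion_free_connection_on A U \<Gamma>' \<and>
     (\<exists>\<sigma>. oneform_on A U \<sigma> \<and> (\<forall>c\<in>A. \<forall>p\<in>U \<inter> fst c. \<forall>k i j.
        \<Gamma>' c p $ k $ i $ j =
          \<Gamma> c p $ k $ i $ j + 2 * sym2 (\<lambda>i j. \<sigma> c p $ i * of_bool (j = k)) i j))}"

definition projective_structure ::
    "('a, 'n::finite) chart set \<Rightarrow> 'a set \<Rightarrow> ('a, 'n) connection set \<Rightarrow> bool" where
  "projective_structure A U P \<longleftrightarrow> P \<in> Collect (torsion_free_connection_on A U) // projective_rel A U"

definition conformal_rel ::
    "('a, 'n::finite) chart set \<Rightarrow> 'a set \<Rightarrow> (('a, 'n) metric \<times> ('a, 'n) metric) set" where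
  "conformal_rel A U = {(g, g').
     metric_on A U g \<and> metric_on A U g' \<and>
     (\<exists>f. smooth_fun A U f \<and> (\<forall>p\<in>U. f p > 0) \<and>
        (\<forall>c\<in>A. \<forall>p\<in>U \<inter> fst c. g' c p = f p *\<^sub>R g c p))}"

definition conformal_structure ::
    "('a, 'n::finite) chart set \<Rightarrow> 'a set \<Rightarrow> ('a, 'n) metric set \<Rightarrow> bool" where
  "conformal_structure A U G \<longleftrightarrow> G \<in> Collect (metric_on A U) // conformal_rel A U"

text \<open>The representatives, over an open \<open>U\<close>, of the structure that \<open>P\<close> (resp. \<open>G\<close>) induces on \<open>U\<close>.
  Such a representative need not be the restriction of an element of \<open>P\<close> (resp. \<open>G\<close>), as the one-form
  (resp. conformal factor) relating the two is only defined on \<open>U\<close>.\<close>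

definition projective_reps_on ::
    "('a, 'n::finite) chart set \<Rightarrow> 'a set \<Rightarrow> ('a, 'n) connection set \<Rightarrow> ('a, 'n) connection set" where
  "projective_reps_on A U P = projective_rel A U `` (restrict_field U ` P)"

definition conformal_reps_on ::
    "('a, 'n::finite) chart set \<Rightarrow> 'a set \<Rightarrow> ('a, 'n) metric set \<Rightarrow> ('a, 'n) metric set" where
  "conformal_reps_on A U G = conformal_rel A U `` (restrict_field U ` G)"


section \<open>Statistical structures, alignment, AH structures\<close>

text \<open>\<open>cov_deriv \<Gamma> g c p i j k\<close> is \<open>\<nabla>\<^sub>i g\<^sub>j\<^sub>k\<close> in the chart \<open>c\<close>.\<close>

definition cov_deriv ::
    "('a, 'n::finite) connection \<Rightarrow> ('a, 'n) metric \<Rightarrow> ('a, 'n) chart \<Rightarrow> 'a \<Rightarrow> 'n \<Rightarrow> 'n \<Rightarrow> 'n \<Rightarrow> real" where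
  "cov_deriv \<Gamma> g c p i j k =
     coord_deriv c i (\<lambda>q. g c q $ j $ k) p
     - (\<Sum>m\<in>UNIV. \<Gamma> c p $ m $ i $ j * g c p $ m $ k)
     - (\<Sum>m\<in>UNIV. \<Gamma> c p $ m $ i $ k * g c p $ j $ m)"

definition statistical_structure ::
    "('a, 'n::finite) chart set \<Rightarrow> 'a set \<Rightarrow> ('a, 'n) connection \<Rightarrow> ('a, 'n) metric \<Rightarrow> bool" where
  "statistical_structure A U \<Gamma> g \<longleftrightarrow> torsion_free_connection_on A U \<Gamma> \<and> metric_on A U g \<and>
     (\<forall>c\<in>A. \<forall>p\<in>U \<inter> fst c. \<forall>i j k. alt2 (\<lambda>i j. cov_deriv \<Gamma> g c p i j k) i j = 0)"

definition locally_statistical ::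
    "'a topology \<Rightarrow> ('a, 'n::finite) chart set \<Rightarrow> ('a, 'n) connection set \<Rightarrow> ('a, 'n) metric set \<Rightarrow> bool" where
  "locally_statistical M A P G \<longleftrightarrow>
     (\<forall>p\<in>topspace M. \<exists>U. openin M U \<and> p \<in> U \<and>
        (\<exists>\<Gamma>\<in>projective_reps_on A U P. \<exists>g\<in>conformal_reps_on A U G. statistical_structure A U \<Gamma> g))"

definition aligned ::
    "('a, 'n::finite) chart set \<Rightarrow> 'a set \<Rightarrow> ('a, 'n) connection \<Rightarrow> ('a, 'n) metric set \<Rightarrow> bool" where
  "aligned A U \<Gamma> G \<longleftrightarrow> (\<forall>g\<in>G. \<forall>c\<in>A. \<forall>x\<in>U \<inter> fst c. \<forall>i.
     (\<Sum>p\<in>UNIV. \<Sum>q\<in>UNIV. matrix_inv (g c x) $ p $ q * cov_deriv \<Gamma> g c x i p q) =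
     real CARD('n) * (\<Sum>p\<in>UNIV. \<Sum>q\<in>UNIV. matrix_inv (g c x) $ p $ q * cov_deriv \<Gamma> g c x p q i))"

definition AH_structure ::
    "('a, 'n::finite) chart set \<Rightarrow> 'a set \<Rightarrow> ('a, 'n) connection \<Rightarrow> ('a, 'n) metric set \<Rightarrow> bool" where
  "AH_structure A U \<Gamma> G \<longleftrightarrow> torsion_free_connection_on A U \<Gamma> \<and> aligned A U \<Gamma> G \<and>
     (\<forall>g\<in>G. \<exists>\<omega>. oneform_on A U \<omega> \<and> (\<forall>c\<in>A. \<forall>p\<in>U \<inter> fst c. \<forall>i j k.
        alt2 (\<lambda>i j. cov_deriv \<Gamma> g c p i j k) i j = alt2 (\<lambda>i j. \<omega> c p $ i * g c p $ j $ k) i j))"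

text \<open>If \<open>CARD('n) \<ge> 2\<close>, exactly one element of a projective structure is aligned, so the description
  is proper.\<close>

definition aligned_representative ::
    "('a, 'n::finite) chart set \<Rightarrow> 'a set \<Rightarrow> ('a, 'n) connection set \<Rightarrow> ('a, 'n) metric set \<Rightarrow> ('a, 'n) connection" where
  "aligned_representative A U P G = (THE \<Gamma>. \<Gamma> \<in> P \<and> aligned A U \<Gamma> G)"

end

theory Submission
  imports Defs
begin

text \<open>A projective change of \<open>\<nabla>\<close> by \<open>\<sigma>\<close> subtracts \<open>\<sigma>\<^bsub>[i\<^esub>g\<^bsub>j]k\<^esub>\<close> from \<open>\<nabla>\<^bsub>[i\<^esub>g\<^bsub>j]k\<^esub>\<close>, and replacing
  \<open>g\<close> by \<open>f g\<close> turns \<open>\<nabla>\<^bsub>[i\<^esub>g\<^bsub>j]k\<^esub>\<close> into \<open>f \<nabla>\<^bsub>[i\<^esub>g\<^bsub>j]k\<^esub> + df\<^bsub>[i\<^esub>g\<^bsub>j]k\<^esub>\<close>. So the AH condition for one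
  representative of \<open>[\<nabla>]\<close> produces a statistical one by shifting by \<open>\<chi>\<close>; conversely a local
  statistical representative shows that at each point \<open>\<nabla>\<^bsub>[i\<^esub>g\<^bsub>j]k\<^esub> = v\<^bsub>[i\<^esub>g\<^bsub>j]k\<^esub>\<close> for some covector
  \<open>v\<close>. As \<open>n \<ge> 2\<close> and \<open>\<nabla>\<close> is aligned, taking traces forces \<open>n v\<^sub>i = g\<^sup>p\<^sup>q \<nabla>\<^sub>i g\<^sub>p\<^sub>q\<close>, so these covectors
  form a global smooth one-form.\<close>

section \<open>Calculus of smooth functions\<close>

lemma has_derivative_cong_nhds:
  assumes "eventually (\<lambda>x. f x = g x) (nhds x)" "(f has_derivative D) (at x)"
  shows "(g has_derivative D) (at x)"
  using has_derivative_transform_eventually[OF assms(2), of g] assms(1)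
  by (simp add: eventually_nhds_conv_at)

text \<open>As \<open>S\<close> is open, agreement on \<open>S\<close> is agreement near each of its
  points. So the derivatives agree as well, and the induction hypothesis applies to them in every
  direction \<open>v\<close>.\<close>

lemma Ck_on_cong:
  assumes "open S" "\<And>x. x \<in> S \<Longrightarrow> f x = g x" "Ck_on k S f"
  shows "Ck_on k S g"
  using assms(2,3)
proof (induction k arbitrary: f g)
  case 0
  then show ?case using continuous_on_cong by force
next
  case (Suc k)
  have D: "(g has_derivative frechet_derivative f (at x)) (at x)" if "x \<in> S" for x
  proof (rule has_derivative_transform_within_open[OF _ assms(1) that])
    show "(f has_derivative frechet_derivative f (at x)) (at x)"
      unfolding frechet_derivative_works[symmetric] using Suc.prems(2) that by simp
  qed (rule Suc.prems(1))
  show ?case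
    unfolding Ck_on.simps
  proof (intro conjI ballI allI)
    fix x assume "x \<in> S"
    then show "g differentiable at x" using D differentiableI by blast
  next
    fix v
    show "Ck_on k S (\<lambda>x. frechet_derivative g (at x) v)"
      proof (rule Suc.IH)
      show "Ck_on k S (\<lambda>x. frechet_derivative f (at x) v)" using Suc.prems(2) by simp
      show "frechet_derivative f (at x) v = frechet_derivative g (at x) v" if "x \<in> S" for x
        using frechet_derivative_at[OF D[OF that]] by simp
    qed
  qed
qed

text \<open>Replaces \<open>frechet_derivative\<close> by any explicitly known derivative; the
  closure rules below feed it the usual differentiation rules.\<close>

lemma Ck_on_SucI:
  assumes "open S" "\<And>x. x \<in> S \<Longrightarrow> (f has_derivative f' x) (at x)"
    and "\<And>v. Ck_on k S (\<lambda>x. f' x v)"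
  shows "Ck_on (Suc k) S f"
  unfolding Ck_on.simps
proof (intro conjI ballI allI)
  fix x assume "x \<in> S"
  then show "f differentiable at x" using assms(2) differentiableI by blast
next
  fix v
  show "Ck_on k S (\<lambda>x. frechet_derivative f (at x) v)"
    by (rule Ck_on_cong[OF assms(1) _ assms(3)[of v]])
      (simp add: frechet_derivative_at[OF assms(2), symmetric])
qed

text \<open>The recursion in \<open>Ck_on\<close> mentions continuity only at the bottom level, so
  monotonicity in \<open>k\<close> is an induction whose base case is that differentiable functions
  are continuous.\<close>

lemma Ck_on_Suc_imp: "Ck_on (Suc k) S f \<Longrightarrow> Ck_on k S f"
proof (induction k arbitrary: f)
  case 0
  then show ?case
    by (auto intro!: continuous_at_imp_continuous_on differentiable_imp_continuous_within)
next
  case (Suc k)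
  show ?case
    unfolding Ck_on.simps(2)[of k]
    using Suc.prems[unfolded Ck_on.simps(2)[of "Suc k"]]
    by (auto intro: Suc.IH simp del: Ck_on.simps)
qed

lemma Ck_on_Suc_has_derivative:
  "Ck_on (Suc k) S f \<Longrightarrow> x \<in> S \<Longrightarrow> (f has_derivative frechet_derivative f (at x)) (at x)"
  unfolding frechet_derivative_works[symmetric] by simp

lemma Ck_on_subset: "Ck_on k S f \<Longrightarrow> T \<subseteq> S \<Longrightarrow> Ck_on k T f"
  by (induction k arbitrary: f) (auto intro: continuous_on_subset)

lemma Ck_on_const: "Ck_on k S (\<lambda>x. a)"
  by (induction k arbitrary: a) auto

lemma Ck_on_bounded_linear:
  assumes "open S" "bounded_linear L"
  shows "Ck_on k S f \<Longrightarrow> Ck_on k S (\<lambda>x. L (f x))"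
proof (induction k arbitrary: f)
  case 0
  then show ?case using bounded_linear.continuous_on[OF assms(2)] by auto
next
  case (Suc k)
  show ?case
    by (rule Ck_on_SucI[OF assms(1) bounded_linear.has_derivative[OF assms(2)
          Ck_on_Suc_has_derivative[OF Suc.prems]]])
      (use Suc in auto)
qed

lemma Ck_on_add:
  assumes "open S"
  shows "Ck_on k S f \<Longrightarrow> Ck_on k S g \<Longrightarrow> Ck_on k S (\<lambda>x. f x + g x)"
proof (induction k arbitrary: f g)
  case 0
  then show ?case by (auto intro: continuous_on_add)
next
  case (Suc k)
  show ?case
    by (rule Ck_on_SucI[OF assms has_derivative_add[OF
          Ck_on_Suc_has_derivative[OF Suc.prems(1)] Ck_on_Suc_has_derivative[OF Suc.prems(2)]]])
      (use Suc in auto)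
qed

lemma Ck_on_mult:
  fixes f g :: "'v::real_normed_vector \<Rightarrow> real"
  assumes "open S"
  shows "Ck_on k S f \<Longrightarrow> Ck_on k S g \<Longrightarrow> Ck_on k S (\<lambda>x. f x * g x)"
proof (induction k arbitrary: f g)
  case 0
  then show ?case by (auto intro: continuous_on_mult)
next
  case (Suc k)
  \<comment> \<open>The product rule also brings in \<open>f\<close> and \<open>g\<close>
    themselves, so their order is lowered to \<open>k\<close> before the induction hypothesis is
    applied.\<close>
  note f = Ck_on_Suc_imp[OF Suc.prems(1)] and g = Ck_on_Suc_imp[OF Suc.prems(2)]
  show ?case
    by (rule Ck_on_SucI[OF assms has_derivative_mult[OF
          Ck_on_Suc_has_derivative[OF Suc.prems(1)] Ck_on_Suc_has_derivative[OF Suc.prems(2)]]])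
      (use Suc f g in \<open>auto intro!: Ck_on_add[OF assms]\<close>)
qed

lemma Ck_on_inverse:
  fixes f :: "'v::real_normed_vector \<Rightarrow> real"
  assumes "open S" "\<And>x. x \<in> S \<Longrightarrow> f x \<noteq> 0"
  shows "Ck_on k S f \<Longrightarrow> Ck_on k S (\<lambda>x. inverse (f x))"
proof (induction k)
  case 0
  then show ?case using assms(2) by (auto intro: continuous_on_inverse)
next
  case (Suc k)
  note f = Suc.IH[OF Ck_on_Suc_imp[OF Suc.prems]]
  \<comment> \<open>The derivative of \<open>1/f\<close> is \<open>- (1/f) f' (1/f)\<close>, whose
    factors \<open>1/f\<close> are of order \<open>k\<close> by the induction hypothesis.\<close>
  have "Ck_on k S (\<lambda>x. -1 * (inverse (f x) * frechet_derivative f (at x) v * inverse (f x)))" for v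
    using Suc.prems f by (intro Ck_on_mult[OF assms(1)] Ck_on_const) auto
  then show ?case
    by (intro Ck_on_SucI[OF assms(1) Deriv.has_derivative_inverse[OF assms(2)
          Ck_on_Suc_has_derivative[OF Suc.prems]]]) auto
qed

lemma smooth_on_cong:
  "open S \<Longrightarrow> (\<And>x. x \<in> S \<Longrightarrow> f x = g x) \<Longrightarrow> smooth_on S f \<Longrightarrow> smooth_on S g"
  unfolding smooth_on_def by (rule allI, rule Ck_on_cong[of S f]) auto

lemma smooth_on_const: "smooth_on S (\<lambda>x. a)"
  by (simp add: smooth_on_def Ck_on_const)

lemma smooth_on_bounded_linear:
  "open S \<Longrightarrow> bounded_linear L \<Longrightarrow> smooth_on S f \<Longrightarrow> smooth_on S (\<lambda>x. L (f x))"
  unfolding smooth_on_def by (rule allI, rule Ck_on_bounded_linear) auto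

lemma smooth_on_add:
  "open S \<Longrightarrow> smooth_on S f \<Longrightarrow> smooth_on S g \<Longrightarrow> smooth_on S (\<lambda>x. f x + g x)"
  unfolding smooth_on_def by (rule allI, rule Ck_on_add) auto

lemma smooth_on_mult:
  fixes f g :: "'v::real_normed_vector \<Rightarrow> real"
  shows "open S \<Longrightarrow> smooth_on S f \<Longrightarrow> smooth_on S g \<Longrightarrow> smooth_on S (\<lambda>x. f x * g x)"
  unfolding smooth_on_def by (rule allI, rule Ck_on_mult) auto

lemma smooth_on_inverse:
  fixes f :: "'v::real_normed_vector \<Rightarrow> real"
  shows "open S \<Longrightarrow> (\<And>x. x \<in> S \<Longrightarrow> f x \<noteq> 0) \<Longrightarrow> smooth_on S f \<Longrightarrow> smooth_on S (\<lambda>x. inverse (f x))"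
  unfolding smooth_on_def by (rule allI, rule Ck_on_inverse) auto

lemma smooth_on_frechet_derivative:
  "smooth_on S f \<Longrightarrow> smooth_on S (\<lambda>x. frechet_derivative f (at x) v)"
  using Ck_on.simps(2)[of _ S f] unfolding smooth_on_def by auto

lemma smooth_on_differentiable: "smooth_on S f \<Longrightarrow> x \<in> S \<Longrightarrow> f differentiable at x"
  using Ck_on.simps(2)[of 0 S f] unfolding smooth_on_def by auto

section \<open>Smooth functions and coordinate derivatives in a chart\<close>

definition diff_in_chart :: "('a, 'n::finite) chart \<Rightarrow> ('a \<Rightarrow> real) \<Rightarrow> 'a \<Rightarrow> bool" where
  "diff_in_chart c f p \<longleftrightarrow> (f \<circ> chart_inv c) differentiable at (snd c p)"

locale smooth_mfd =
  fixes M :: "'a topology" and A :: "('a, 'n::finite) chart set"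
  assumes mfd: "smooth_manifold M A"
begin

lemma chart_on_atlas: "c \<in> A \<Longrightarrow> chart_on M c"
  using mfd by (simp add: smooth_manifold_def)

lemma chart_dom_open: "c \<in> A \<Longrightarrow> openin M (fst c)"
  using chart_on_atlas by (auto simp: chart_on_def)

lemma chart_inj:
  assumes "c \<in> A"
  shows "inj_on (snd c) (fst c)"
proof -
  have "inj_on (snd c) (topspace (subtopology M (fst c)))"
    using chart_on_atlas[OF assms] unfolding chart_on_def
    by (intro homeomorphic_imp_injective_map) auto
  then show ?thesis using openin_subset[OF chart_dom_open[OF assms]]
    by (simp add: Int_absorb1)
qed

lemma chart_inv_eq: "c \<in> A \<Longrightarrow> p \<in> fst c \<Longrightarrow> chart_inv c (snd c p) = p"
  unfolding chart_inv_def by (simp add: chart_inj inv_into_f_f)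

lemma open_chart_image:
  assumes "c \<in> A" "openin M U"
  shows "open (snd c ` (U \<inter> fst c))"
proof -
  note c = chart_on_atlas[OF assms(1)]
  have "open_map (subtopology M (fst c)) (top_of_set (snd c ` fst c)) (snd c)"
    using c homeomorphic_imp_open_map unfolding chart_on_def by blast
  moreover have "openin (subtopology M (fst c)) (U \<inter> fst c)"
    using assms(2) by (auto simp: openin_subtopology)
  ultimately have "openin (top_of_set (snd c ` fst c)) (snd c ` (U \<inter> fst c))"
    unfolding open_map_def by blast
  then show ?thesis using c openin_open_eq unfolding chart_on_def by blast
qed

lemma eventually_in_chart:
  assumes "c \<in> A" "openin M U" "p \<in> U \<inter> fst c" "\<And>q. q \<in> U \<inter> fst c \<Longrightarrow> Q q"
  shows "eventually (\<lambda>x. Q (chart_inv c x)) (nhds (snd c p))"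
  unfolding eventually_nhds
  by (rule exI[of _ "snd c ` (U \<inter> fst c)"])
    (use assms open_chart_image[OF assms(1,2)] chart_inv_eq in auto)

lemma coord_deriv_cong:
  assumes "c \<in> A" "openin M U" "p \<in> U \<inter> fst c" "\<And>q. q \<in> U \<inter> fst c \<Longrightarrow> f q = g q"
  shows "coord_deriv c i f p = coord_deriv c i g p"
proof -
  have "eventually (\<lambda>x. (f \<circ> chart_inv c) x = (g \<circ> chart_inv c) x) (nhds (snd c p))"
    using eventually_in_chart[OF assms(1-3), of "\<lambda>q. f q = g q"] assms(4) by simp
  \<comment> \<open>\<open>frechet_derivative\<close> is a choice among the derivatives, so it
    suffices that both functions have the same ones; this covers the non-differentiable case
    too.\<close>
  then have "((f \<circ> chart_inv c) has_derivative D) (at (snd c p)) \<longleftrightarrow>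
      ((g \<circ> chart_inv c) has_derivative D) (at (snd c p))" for D
    using has_derivative_cong_nhds[of "f \<circ> chart_inv c" "g \<circ> chart_inv c"]
      has_derivative_cong_nhds[of "g \<circ> chart_inv c" "f \<circ> chart_inv c"]
    by (auto simp: eq_commute)
  then show ?thesis by (simp add: coord_deriv_def frechet_derivative_def)
qed

lemma smooth_in_chart_cong:
  assumes "c \<in> A" "openin M U" "\<And>q. q \<in> U \<inter> fst c \<Longrightarrow> f q = g q" "smooth_in_chart c U f"
  shows "smooth_in_chart c U g"
  unfolding smooth_in_chart_def
  by (rule smooth_on_cong[OF open_chart_image[OF assms(1,2)] _ assms(4)[unfolded smooth_in_chart_def]])
    (use assms(3) chart_inv_eq[OF assms(1)] in auto)

lemma smooth_in_chart_const: "smooth_in_chart c U (\<lambda>p. a)"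
  unfolding smooth_in_chart_def comp_def by (rule smooth_on_const)

lemma smooth_in_chart_add:
  assumes "c \<in> A" "openin M U" "smooth_in_chart c U f" "smooth_in_chart c U g"
  shows "smooth_in_chart c U (\<lambda>p. f p + g p)"
  using smooth_on_add[OF open_chart_image[OF assms(1,2)], of "f \<circ> chart_inv c" "g \<circ> chart_inv c"]
    assms(3,4) by (simp add: smooth_in_chart_def comp_def)

lemma smooth_in_chart_mult:
  assumes "c \<in> A" "openin M U" "smooth_in_chart c U f" "smooth_in_chart c U g"
  shows "smooth_in_chart c U (\<lambda>p. f p * g p)"
  using smooth_on_mult[OF open_chart_image[OF assms(1,2)], of "f \<circ> chart_inv c" "g \<circ> chart_inv c"]
    assms(3,4) by (simp add: smooth_in_chart_def comp_def)

lemma smooth_in_chart_diff: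
  assumes "c \<in> A" "openin M U" "smooth_in_chart c U f" "smooth_in_chart c U g"
  shows "smooth_in_chart c U (\<lambda>p. f p - g p)"
  using smooth_in_chart_add[OF assms(1-3) smooth_in_chart_mult[OF assms(1,2)
        smooth_in_chart_const[where a = "-1"] assms(4)]] by simp

lemma smooth_in_chart_inverse:
  assumes "c \<in> A" "openin M U" "\<And>p. p \<in> U \<inter> fst c \<Longrightarrow> f p \<noteq> 0" "smooth_in_chart c U f"
  shows "smooth_in_chart c U (\<lambda>p. inverse (f p))"
proof -
  have "f (chart_inv c x) \<noteq> 0" if "x \<in> snd c ` (U \<inter> fst c)" for x
    using that assms(3) chart_inv_eq[OF assms(1)] by auto
  then show ?thesis
    using smooth_on_inverse[OF open_chart_image[OF assms(1,2)], of "f \<circ> chart_inv c"] assms(4)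
    by (simp add: smooth_in_chart_def comp_def)
qed

lemma smooth_in_chart_sum:
  assumes "c \<in> A" "openin M U" "\<And>k. k \<in> I \<Longrightarrow> smooth_in_chart c U (f k)"
  shows "smooth_in_chart c U (\<lambda>p. \<Sum>k\<in>I. f k p)"
  using assms(3)
  by (induction I rule: infinite_finite_induct)
    (auto intro: smooth_in_chart_const smooth_in_chart_add[OF assms(1,2)])

lemma smooth_in_chart_prod:
  assumes "c \<in> A" "openin M U" "\<And>k. k \<in> I \<Longrightarrow> smooth_in_chart c U (f k)"
  shows "smooth_in_chart c U (\<lambda>p. \<Prod>k\<in>I. f k p)"
  using assms(3)
  by (induction I rule: infinite_finite_induct)
    (auto intro: smooth_in_chart_const smooth_in_chart_mult[OF assms(1,2)])

lemma smooth_in_chart_coord_deriv: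
  assumes "c \<in> A" "openin M U" "smooth_in_chart c U f"
  shows "smooth_in_chart c U (coord_deriv c i f)"
  unfolding smooth_in_chart_def
  by (rule smooth_on_cong[OF open_chart_image[OF assms(1,2)] _
        smooth_on_frechet_derivative[OF assms(3)[unfolded smooth_in_chart_def], of "axis i 1"]])
    (use chart_inv_eq[OF assms(1)] in \<open>auto simp: coord_deriv_def\<close>)

lemma smooth_in_chart_subset:
  assumes "smooth_in_chart c U f" "V \<subseteq> U"
  shows "smooth_in_chart c V f"
proof -
  have "snd c ` (V \<inter> fst c) \<subseteq> snd c ` (U \<inter> fst c)" using assms(2) by blast
  then show ?thesis
    using assms(1) unfolding smooth_in_chart_def smooth_on_def by (metis Ck_on_subset)
qed

lemma smooth_in_chart_imp_diff:
  "smooth_in_chart c U f \<Longrightarrow> p \<in> U \<inter> fst c \<Longrightarrow> diff_in_chart c f p"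
  unfolding smooth_in_chart_def diff_in_chart_def
  by (rule smooth_on_differentiable) auto

section \<open>Product, sum and chain rules for coordinate derivatives\<close>

lemma coord_deriv_mult:
  assumes "c \<in> A" "p \<in> fst c" "diff_in_chart c f p" "diff_in_chart c g p"
  shows "coord_deriv c i (\<lambda>q. f q * g q) p = coord_deriv c i f p * g p + f p * coord_deriv c i g p"
    and "diff_in_chart c (\<lambda>q. f q * g q) p"
proof -
  let ?f = "f \<circ> chart_inv c" and ?g = "g \<circ> chart_inv c"
  have "((\<lambda>x. ?f x * ?g x) has_derivative
      (\<lambda>h. ?f (snd c p) * frechet_derivative ?g (at (snd c p)) h
         + frechet_derivative ?f (at (snd c p)) h * ?g (snd c p))) (at (snd c p))"
    using assms(3,4) unfolding diff_in_chart_def frechet_derivative_works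
    by (rule has_derivative_mult)
  note * = this[folded comp_def[of "\<lambda>q. f q * g q" "chart_inv c"], unfolded comp_def]
  show "coord_deriv c i (\<lambda>q. f q * g q) p = coord_deriv c i f p * g p + f p * coord_deriv c i g p"
    using frechet_derivative_at[OF *, symmetric] chart_inv_eq[OF assms(1,2)]
    unfolding coord_deriv_def comp_def by simp
  show "diff_in_chart c (\<lambda>q. f q * g q) p"
    using differentiableI[OF *] by (simp add: diff_in_chart_def comp_def)
qed

lemma coord_deriv_sum:
  assumes "finite I" "\<And>k. k \<in> I \<Longrightarrow> diff_in_chart c (f k) p"
  shows "coord_deriv c i (\<lambda>q. \<Sum>k\<in>I. f k q) p = (\<Sum>k\<in>I. coord_deriv c i (f k) p)"
    and "diff_in_chart c (\<lambda>q. \<Sum>k\<in>I. f k q) p"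
proof -
  have *: "((\<lambda>x. \<Sum>k\<in>I. (f k \<circ> chart_inv c) x) has_derivative
      (\<lambda>h. \<Sum>k\<in>I. frechet_derivative (f k \<circ> chart_inv c) (at (snd c p)) h)) (at (snd c p))"
    using assms(2) unfolding diff_in_chart_def frechet_derivative_works
    by (rule has_derivative_sum)
  show "coord_deriv c i (\<lambda>q. \<Sum>k\<in>I. f k q) p = (\<Sum>k\<in>I. coord_deriv c i (f k) p)"
    using frechet_derivative_at[OF *, symmetric] unfolding coord_deriv_def comp_def by simp
  show "diff_in_chart c (\<lambda>q. \<Sum>k\<in>I. f k q) p"
    using differentiableI[OF *] by (simp add: diff_in_chart_def comp_def)
qed

lemma transition_smooth:
  assumes "c \<in> A" "d \<in> A"
  shows "smooth_on (snd c ` (fst c \<inter> fst d)) (snd d \<circ> chart_inv c)"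
  using mfd assms by (simp add: smooth_manifold_def)

lemma jac_smooth:
  assumes "c \<in> A" "d \<in> A"
  shows "smooth_in_chart c (fst d) (jac c d a i)"
proof -
  have "smooth_in_chart c (fst d) (\<lambda>q. snd d q $ a)"
    using smooth_on_bounded_linear[OF open_chart_image[OF assms(1) chart_dom_open[OF assms(2)]]
        bounded_linear_vec_nth[of a]] transition_smooth[OF assms]
    unfolding smooth_in_chart_def comp_def by (simp add: Int_commute)
  then show ?thesis
    unfolding jac_def by (rule smooth_in_chart_coord_deriv[OF assms(1) chart_dom_open[OF assms(2)]])
qed

text \<open>Near \<open>snd c p\<close>, the function \<open>f\<close> read in \<open>c\<close> is
  \<open>f\<close> read in \<open>d\<close> composed with the transition map. The derivative of the
  transition map sends the \<open>i\<close>-th basis vector to the \<open>i\<close>-th column of the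
  Jacobian.\<close>

lemma coord_deriv_chain:
  assumes "c \<in> A" "d \<in> A" "p \<in> fst c \<inter> fst d" "diff_in_chart d f p"
  shows "coord_deriv c i f p = (\<Sum>a\<in>UNIV. jac c d a i p * coord_deriv d a f p)"
    and "diff_in_chart c f p"
proof -
  let ?x = "snd c p" and ?T = "snd d \<circ> chart_inv c" and ?f = "f \<circ> chart_inv d"
  have Tx: "?T ?x = snd d p" using assms by (simp add: chart_inv_eq)
  define DT where "DT = frechet_derivative ?T (at ?x)"
  define Df where "Df = frechet_derivative ?f (at (snd d p))"
  have T: "(?T has_derivative DT) (at ?x)"
    unfolding DT_def frechet_derivative_works[symmetric]
    by (rule smooth_on_differentiable[OF transition_smooth[OF assms(1,2)]])
      (use assms(3) in auto)
  have F: "(?f has_derivative Df) (at (?T ?x))"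
    unfolding Tx Df_def frechet_derivative_works[symmetric]
    using assms(4) by (simp add: diff_in_chart_def)
  have "(?f \<circ> ?T has_derivative Df \<circ> DT) (at ?x)" by (rule diff_chain_at[OF T F])
  moreover have "eventually (\<lambda>x. (?f \<circ> ?T) x = (f \<circ> chart_inv c) x) (nhds ?x)"
    using eventually_in_chart[OF assms(1) chart_dom_open[OF assms(2)], of p
        "\<lambda>q. f (chart_inv d (snd d q)) = f q"] assms chart_inv_eq by simp
  ultimately have FT: "(f \<circ> chart_inv c has_derivative Df \<circ> DT) (at ?x)"
    by (intro has_derivative_cong_nhds[of "?f \<circ> ?T" "f \<circ> chart_inv c"])
  then show "diff_in_chart c f p" unfolding diff_in_chart_def by (rule differentiableI)
  have J: "jac c d a i p = DT (axis i 1) $ a" for a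
  proof -
    have "((\<lambda>q. snd d q $ a) \<circ> chart_inv c has_derivative (\<lambda>h. DT h $ a)) (at ?x)"
      using bounded_linear.has_derivative[OF bounded_linear_vec_nth[of a] T] by (simp add: comp_def)
    from frechet_derivative_at[OF this] show ?thesis
      unfolding jac_def coord_deriv_def by (simp add: fun_eq_iff)
  qed
  have lin: "linear Df" using F has_derivative_linear by blast
  have "coord_deriv c i f p = Df (DT (axis i 1))"
    unfolding coord_deriv_def frechet_derivative_at[OF FT, symmetric] by simp
  also have "DT (axis i 1) = (\<Sum>a\<in>UNIV. (DT (axis i 1) $ a) *\<^sub>R axis a 1)"
    using basis_expansion[of "DT (axis i 1)"] by (simp add: scalar_mult_eq_scaleR)
  also have "Df \<dots> = (\<Sum>a\<in>UNIV. jac c d a i p * coord_deriv d a f p)"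
    unfolding coord_deriv_def Df_def[symmetric] by (simp add: linear_sum[OF lin] linear_scale[OF lin] J)
  finally show "coord_deriv c i f p = (\<Sum>a\<in>UNIV. jac c d a i p * coord_deriv d a f p)" .
qed

end

section \<open>Traces with respect to a metric\<close>

text \<open>For square matrices a right inverse is two-sided, and two-sided inverses are unique, so
  the choice made by \<open>matrix_inv\<close> must be \<open>B\<close>.\<close>

lemma matrix_inv_eqI:
  fixes A :: "real ^ 'n ^ 'n"
  assumes "A ** B = mat 1"
  shows "matrix_inv A = B"
proof -
  have BA: "B ** A = mat 1" using assms matrix_left_right_inverse by blast
  have "A ** matrix_inv A = mat 1 \<and> matrix_inv A ** A = mat 1"
    unfolding matrix_inv_def by (rule someI[of _ B]) (simp add: assms BA)
  then have "matrix_inv A = (B ** A) ** matrix_inv A"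
    by (simp add: BA)
  also have "\<dots> = B"
    using \<open>_ \<and> _\<close> by (simp add: matrix_mul_assoc[symmetric])
  finally show ?thesis .
qed

lemma matrix_inv_mult:
  fixes A :: "real ^ 'n ^ 'n"
  assumes "invertible A"
  shows "A ** matrix_inv A = mat 1" "matrix_inv A ** A = mat 1"
proof -
  obtain B where "A ** B = mat 1" "B ** A = mat 1" using assms by (auto simp: invertible_def)
  then show "A ** matrix_inv A = mat 1" "matrix_inv A ** A = mat 1" using matrix_inv_eqI by metis+
qed

text \<open>Cramer's rule for the \<open>q\<close>-th column of the inverse. It exhibits each entry
  as a polynomial in the entries of \<open>A\<close> divided by \<open>det A\<close>, which later
  gives smoothness of the inverse metric.\<close>

lemma matrix_inv_component:
  fixes A :: "real ^ 'n ^ 'n"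
  assumes "invertible A"
  shows "matrix_inv A $ k $ q = det (\<chi> i j. if j = k then axis q 1 $ i else A $ i $ j) * inverse (det A)"
proof -
  have "A *v (matrix_inv A *v axis q 1) = axis q 1"
    by (simp add: matrix_vector_mul_assoc matrix_inv_mult[OF assms])
  moreover have "det A \<noteq> 0" using assms by (simp add: invertible_det_nz)
  ultimately have "matrix_inv A *v axis q 1 =
      (\<chi> k. det (\<chi> i j. if j = k then axis q 1 $ i else A $ i $ j) / det A)"
    by (simp add: cramer)
  then have "column q (matrix_inv A) $ k = det (\<chi> i j. if j = k then axis q 1 $ i else A $ i $ j) / det A"
    by (simp add: matrix_vector_mult_basis)
  then show ?thesis by (simp add: column_def divide_inverse)
qed

lemma matrix_inv_scaleR:
  fixes A :: "real ^ 'n ^ 'n"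
  assumes "invertible A" "r \<noteq> 0"
  shows "matrix_inv (r *\<^sub>R A) = inverse r *\<^sub>R matrix_inv A"
  by (rule matrix_inv_eqI)
    (use assms matrix_inv_mult[OF assms(1)] in
      \<open>simp add: scalar_matrix_assoc[symmetric] matrix_scalar_ac\<close>)

lemma matrix_inv_contract:
  fixes A :: "real ^ 'n::finite ^ 'n"
  assumes "invertible A" "transpose A = A"
  shows "(\<Sum>q\<in>UNIV. matrix_inv A $ p $ q * A $ q $ i) = of_bool (p = i)"
    and "(\<Sum>p\<in>UNIV. matrix_inv A $ p $ q * A $ p $ i) = of_bool (q = i)"
proof -
  have sym: "A $ i $ j = A $ j $ i" for i j using assms(2) by (metis transpose_def vec_lambda_beta)
  show "(\<Sum>q\<in>UNIV. matrix_inv A $ p $ q * A $ q $ i) = of_bool (p = i)"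
    using arg_cong[OF matrix_inv_mult(2)[OF assms(1)], of "\<lambda>B. B $ p $ i"]
    by (simp add: matrix_matrix_mult_def mat_def)
  have "(\<Sum>p\<in>UNIV. A $ i $ p * matrix_inv A $ p $ q) = of_bool (q = i)"
    using arg_cong[OF matrix_inv_mult(1)[OF assms(1)], of "\<lambda>B. B $ i $ q"]
    by (auto simp: matrix_matrix_mult_def mat_def)
  then show "(\<Sum>p\<in>UNIV. matrix_inv A $ p $ q * A $ p $ i) = of_bool (q = i)"
    by (simp add: sym[of i] mult.commute)
qed

text \<open>These are the shapes in which a covector and the metric occur in the changes of
  \<open>nabla g\<close>. Contraction turns the metric into a Kronecker delta; only the first shape
  picks up the dimension, as the trace of the identity.\<close>

lemma trace_metric:
  fixes A :: "real ^ 'n::finite ^ 'n"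
  assumes "invertible A" "transpose A = A"
  shows "(\<Sum>p\<in>UNIV. \<Sum>q\<in>UNIV. matrix_inv A $ p $ q * (r * A $ p $ q)) = real CARD('n) * r"
    and "(\<Sum>p\<in>UNIV. \<Sum>q\<in>UNIV. matrix_inv A $ p $ q * (s p * A $ q $ i)) = s i"
    and "(\<Sum>p\<in>UNIV. \<Sum>q\<in>UNIV. matrix_inv A $ p $ q * (s q * A $ p $ i)) = s i"
proof -
  have sym: "A $ i $ j = A $ j $ i" for i j using assms(2) by (metis transpose_def vec_lambda_beta)
  have "(\<Sum>p\<in>UNIV. \<Sum>q\<in>UNIV. matrix_inv A $ p $ q * (r * A $ p $ q)) =
      (\<Sum>p\<in>UNIV. r * (\<Sum>q\<in>UNIV. matrix_inv A $ p $ q * A $ q $ p))"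
    unfolding sum_distrib_left by (intro sum.cong refl) (simp add: sym[of _ "_::'n"])
  also have "\<dots> = real CARD('n) * r" by (simp add: matrix_inv_contract[OF assms])
  finally show "(\<Sum>p\<in>UNIV. \<Sum>q\<in>UNIV. matrix_inv A $ p $ q * (r * A $ p $ q)) = real CARD('n) * r" .
  have "(\<Sum>p\<in>UNIV. \<Sum>q\<in>UNIV. matrix_inv A $ p $ q * (s p * A $ q $ i)) =
      (\<Sum>p\<in>UNIV. s p * (\<Sum>q\<in>UNIV. matrix_inv A $ p $ q * A $ q $ i))"
    unfolding sum_distrib_left by (intro sum.cong refl) simp
  also have "\<dots> = s i" by (simp add: matrix_inv_contract[OF assms])
  finally show "(\<Sum>p\<in>UNIV. \<Sum>q\<in>UNIV. matrix_inv A $ p $ q * (s p * A $ q $ i)) = s i" .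
  have "(\<Sum>p\<in>UNIV. \<Sum>q\<in>UNIV. matrix_inv A $ p $ q * (s q * A $ p $ i)) =
      (\<Sum>q\<in>UNIV. s q * (\<Sum>p\<in>UNIV. matrix_inv A $ p $ q * A $ p $ i))"
    unfolding sum_distrib_left by (subst sum.swap, intro sum.cong refl) simp
  also have "\<dots> = s i" by (simp add: matrix_inv_contract[OF assms])
  finally show "(\<Sum>p\<in>UNIV. \<Sum>q\<in>UNIV. matrix_inv A $ p $ q * (s q * A $ p $ i)) = s i" .
qed

section \<open>Traces of the covariant derivative of a metric, and projective changes\<close>

definition trace_last2 ::
    "('a, 'n::finite) connection \<Rightarrow> ('a, 'n) metric \<Rightarrow> ('a, 'n) chart \<Rightarrow> 'a \<Rightarrow> 'n \<Rightarrow> real" where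
  "trace_last2 \<Gamma> g c x i =
     (\<Sum>p\<in>UNIV. \<Sum>q\<in>UNIV. matrix_inv (g c x) $ p $ q * cov_deriv \<Gamma> g c x i p q)"

definition trace_first2 ::
    "('a, 'n::finite) connection \<Rightarrow> ('a, 'n) metric \<Rightarrow> ('a, 'n) chart \<Rightarrow> 'a \<Rightarrow> 'n \<Rightarrow> real" where
  "trace_first2 \<Gamma> g c x i =
     (\<Sum>p\<in>UNIV. \<Sum>q\<in>UNIV. matrix_inv (g c x) $ p $ q * cov_deriv \<Gamma> g c x p q i)"

lemma aligned_iff_trace:
  "aligned A U (\<Gamma> :: ('a, 'n::finite) connection) G \<longleftrightarrow> (\<forall>g\<in>G. \<forall>c\<in>A. \<forall>x\<in>U \<inter> fst c. \<forall>i.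
     trace_last2 \<Gamma> g c x i = real CARD('n) * trace_first2 \<Gamma> g c x i)"
  by (simp add: aligned_def trace_last2_def trace_first2_def)

lemma metric_on_pointwise:
  assumes "metric_on A U g" "c \<in> A" "p \<in> U \<inter> fst c"
  shows "invertible (g c p)" "transpose (g c p) = g c p" "g c p $ i $ j = g c p $ j $ i"
proof -
  show "invertible (g c p)" and t: "transpose (g c p) = g c p"
    using assms by (auto simp: metric_on_def)
  show "g c p $ i $ j = g c p $ j $ i"
    using arg_cong[OF t, of "\<lambda>B. B $ i $ j"] by (simp add: transpose_def)
qed

text \<open>The added term is \<open>s_i delta_j^m + s_j delta_i^m\<close>. With \<open>m\<close>
  lowered by the metric, each of the two Christoffel terms of \<open>nabla_i g_jk\<close> yields one
  \<open>s_i g_jk\<close> and one term with \<open>s_j\<close> or \<open>s_k\<close>.\<close>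

lemma cov_deriv_projective_change:
  assumes "\<And>k i j. \<Gamma>' c p $ k $ i $ j =
      \<Gamma> c p $ k $ i $ j + 2 * sym2 (\<lambda>i j. s $ i * of_bool (j = k)) i j"
    and "\<And>i j. g c p $ i $ j = g c p $ j $ i"
  shows "cov_deriv \<Gamma>' g c p i j k =
      cov_deriv \<Gamma> g c p i j k - 2 * (s $ i * g c p $ j $ k) - s $ j * g c p $ k $ i - s $ k * g c p $ j $ i"
proof -
  \<comment> \<open>The arbitrary \<open>h\<close> lets one computation serve both Christoffel
    terms.\<close>
  have c: "(\<Sum>m\<in>UNIV. \<Gamma>' c p $ m $ i $ j * h m) =
      (\<Sum>m\<in>UNIV. \<Gamma> c p $ m $ i $ j * h m) + s $ i * h j + s $ j * h i" for i j h
  proof -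
    have "\<Gamma>' c p $ m $ i $ j * h m = \<Gamma> c p $ m $ i $ j * h m
        + s $ i * (of_bool (j = m) * h m) + s $ j * (of_bool (i = m) * h m)" for m
      by (simp add: assms(1) sym2_def algebra_simps)
    then show ?thesis by (simp add: sum.distrib sum_distrib_left[symmetric])
  qed
  show ?thesis unfolding cov_deriv_def c by (simp add: assms(2)[of k i])
qed

text \<open>The term \<open>s_k g_ji\<close> is symmetric in \<open>i\<close> and \<open>j\<close>
  and drops out. The terms \<open>2 s_i g_jk\<close> and \<open>s_j g_ki\<close> contribute
  \<open>2 - 1\<close> copies of the alternation of \<open>s_i g_jk\<close>.\<close>

lemma alt2_cov_deriv_projective_change:
  assumes "\<And>k i j. \<Gamma>' c p $ k $ i $ j =
      \<Gamma> c p $ k $ i $ j + 2 * sym2 (\<lambda>i j. s $ i * of_bool (j = k)) i j"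
    and "\<And>i j. g c p $ i $ j = g c p $ j $ i"
  shows "alt2 (\<lambda>i j. cov_deriv \<Gamma>' g c p i j k) i j =
      alt2 (\<lambda>i j. cov_deriv \<Gamma> g c p i j k) i j - alt2 (\<lambda>i j. s $ i * g c p $ j $ k) i j"
  by (simp add: alt2_def cov_deriv_projective_change[of \<Gamma>' c p \<Gamma> s g, OF assms]
      assms(2)[of k] assms(2)[of j i]) (simp add: field_simps)

text \<open>The three correction terms contract to \<open>2 n\<close>, \<open>1\<close> and
  \<open>1\<close> times \<open>s\<close> in the last two indices, and to \<open>2\<close>,
  \<open>1\<close> and \<open>n\<close> times \<open>s\<close> in the first two.\<close>

lemma trace_projective_change:
  fixes g :: "('a, 'n::finite) metric"
  assumes "metric_on A U g" "c \<in> A" "p \<in> U \<inter> fst c"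
    and "\<And>k i j. \<Gamma>' c p $ k $ i $ j =
      \<Gamma> c p $ k $ i $ j + 2 * sym2 (\<lambda>i j. s $ i * of_bool (j = k)) i j"
  shows "trace_last2 \<Gamma>' g c p i = trace_last2 \<Gamma> g c p i - (2 * real CARD('n) + 2) * s $ i"
    and "trace_first2 \<Gamma>' g c p i = trace_first2 \<Gamma> g c p i - (real CARD('n) + 3) * s $ i"
proof -
  note m = metric_on_pointwise[OF assms(1-3)]
  note t = trace_metric[OF m(1,2)]
  note T = cov_deriv_projective_change[of \<Gamma>' c p \<Gamma> s g, OF assms(4) m(3)]
  show "trace_last2 \<Gamma>' g c p i = trace_last2 \<Gamma> g c p i - (2 * real CARD('n) + 2) * s $ i"
    unfolding trace_last2_def T right_diff_distrib sum_subtractf t(2) t(3)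
    using t(1)[of "2 * s $ i"] by (simp add: algebra_simps)
  show "trace_first2 \<Gamma>' g c p i = trace_first2 \<Gamma> g c p i - (real CARD('n) + 3) * s $ i"
    unfolding trace_first2_def T right_diff_distrib sum_subtractf
    using t(1)[of "s $ i"] t(2)[of "\<lambda>p. 2 * s $ p" i] t(3)[of "\<lambda>p. s $ p" i]
      m(3)[of "_::'n" "_::'n"]
    by (simp add: algebra_simps m(3)[of i])
qed

section \<open>Smoothness and transformation laws of the covariant derivative and its traces\<close>

lemma sum_move_3:
  "(\<Sum>p\<in>P. \<Sum>q\<in>Q. \<Sum>a\<in>R. F p q a) = (\<Sum>a\<in>R. \<Sum>p\<in>P. \<Sum>q\<in>Q. F p q a)"
proof -
  have "(\<Sum>p\<in>P. \<Sum>q\<in>Q. \<Sum>a\<in>R. F p q a) = (\<Sum>p\<in>P. \<Sum>a\<in>R. \<Sum>q\<in>Q. F p q a)"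
    by (rule sum.cong[OF refl], rule sum.swap)
  also have "\<dots> = (\<Sum>a\<in>R. \<Sum>p\<in>P. \<Sum>q\<in>Q. F p q a)" by (rule sum.swap)
  finally show ?thesis .
qed

lemma sum_swap_pairs:
  "(\<Sum>p\<in>P. \<Sum>q\<in>Q. \<Sum>a\<in>R. \<Sum>b\<in>S. F p q a b) = (\<Sum>a\<in>R. \<Sum>b\<in>S. \<Sum>p\<in>P. \<Sum>q\<in>Q. F p q a b)"
proof -
  have "(\<Sum>p\<in>P. \<Sum>q\<in>Q. \<Sum>a\<in>R. \<Sum>b\<in>S. F p q a b) = (\<Sum>a\<in>R. \<Sum>p\<in>P. \<Sum>q\<in>Q. \<Sum>b\<in>S. F p q a b)"
    by (rule sum_move_3)
  also have "\<dots> = (\<Sum>a\<in>R. \<Sum>b\<in>S. \<Sum>p\<in>P. \<Sum>q\<in>Q. F p q a b)"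
    by (rule sum.cong[OF refl], rule sum_move_3)
  finally show ?thesis .
qed

lemma metric_on_smooth: "metric_on A U g \<Longrightarrow> c \<in> A \<Longrightarrow> smooth_in_chart c U (\<lambda>p. g c p $ i $ j)"
  by (simp add: metric_on_def)

lemma metric_on_transform:
  assumes "metric_on A U g" "c \<in> A" "d \<in> A" "p \<in> U \<inter> fst c \<inter> fst d"
  shows "g c p $ i $ j = (\<Sum>a\<in>UNIV. \<Sum>b\<in>UNIV. jac c d a i p * jac c d b j p * g d p $ a $ b)"
  using assms unfolding metric_on_def by blast

lemma connection_on_smooth:
  "connection_on A U \<Gamma> \<Longrightarrow> c \<in> A \<Longrightarrow> smooth_in_chart c U (\<lambda>p. \<Gamma> c p $ k $ i $ j)"
  by (simp add: connection_on_def)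

lemma connection_on_transform:
  assumes "connection_on A U \<Gamma>" "c \<in> A" "d \<in> A" "p \<in> U \<inter> fst c \<inter> fst d"
  shows "(\<Sum>k\<in>UNIV. jac c d m k p * \<Gamma> c p $ k $ i $ j) =
      (\<Sum>a\<in>UNIV. \<Sum>b\<in>UNIV. jac c d a i p * jac c d b j p * \<Gamma> d p $ m $ a $ b)
      + coord_deriv c i (jac c d m j) p"
  using assms unfolding connection_on_def by blast

context smooth_mfd
begin

lemma smooth_in_chart_det:
  fixes F :: "'a \<Rightarrow> real ^ 'm::finite ^ 'm"
  assumes "c \<in> A" "openin M U" "\<And>i j. smooth_in_chart c U (\<lambda>p. F p $ i $ j)"
  shows "smooth_in_chart c U (\<lambda>p. det (F p))"
  unfolding det_def
  by (intro smooth_in_chart_sum[OF assms(1,2)] smooth_in_chart_mult[OF assms(1,2)]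
      smooth_in_chart_prod[OF assms(1,2)] smooth_in_chart_const assms(3))

lemma smooth_in_chart_matrix_inv:
  fixes F :: "'a \<Rightarrow> real ^ 'm::finite ^ 'm"
  assumes "c \<in> A" "openin M U" "\<And>i j. smooth_in_chart c U (\<lambda>p. F p $ i $ j)"
    and inv: "\<And>p. p \<in> U \<inter> fst c \<Longrightarrow> invertible (F p)"
  shows "smooth_in_chart c U (\<lambda>p. matrix_inv (F p) $ i $ j)"
proof (rule smooth_in_chart_cong[OF assms(1,2)])
  \<comment> \<open>The matrix in Cramer's numerator has constant entries in column \<open>i\<close>
    and entries of \<open>F\<close> elsewhere.\<close>
  have "smooth_in_chart c U (\<lambda>p. (\<chi> k l. if l = i then axis j 1 $ k else F p $ k $ l) $ k $ l)" for k l
    using smooth_in_chart_const assms(3) by (cases "l = i") simp_all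
  then show "smooth_in_chart c U (\<lambda>p. det (\<chi> k l. if l = i then axis j 1 $ k else F p $ k $ l)
      * inverse (det (F p)))"
    using inv assms(3)
    by (intro smooth_in_chart_mult[OF assms(1,2)] smooth_in_chart_inverse[OF assms(1,2)]
        smooth_in_chart_det[OF assms(1,2)]) (auto simp: invertible_det_nz)
qed (rule matrix_inv_component[OF inv, symmetric])

lemma smooth_cov_deriv:
  assumes "c \<in> A" "openin M U" "connection_on A U \<Gamma>" "metric_on A U g"
  shows "smooth_in_chart c U (\<lambda>p. cov_deriv \<Gamma> g c p i j k)"
proof -
  show ?thesis
    unfolding cov_deriv_def
    by (intro smooth_in_chart_diff[OF assms(1,2)] smooth_in_chart_sum[OF assms(1,2)]
        smooth_in_chart_mult[OF assms(1,2)] smooth_in_chart_coord_deriv[OF assms(1,2)]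
        connection_on_smooth[OF assms(3,1)] metric_on_smooth[OF assms(4,1)])
qed

lemma smooth_traces:
  assumes "c \<in> A" "openin M U" "connection_on A U \<Gamma>" "metric_on A U g"
  shows "smooth_in_chart c U (\<lambda>p. trace_last2 \<Gamma> g c p i)"
    and "smooth_in_chart c U (\<lambda>p. trace_first2 \<Gamma> g c p i)"
proof -
  have inv: "smooth_in_chart c U (\<lambda>p. matrix_inv (g c p) $ i $ j)" for i j
    by (intro smooth_in_chart_matrix_inv[OF assms(1,2)] metric_on_smooth[OF assms(4,1)]
        metric_on_pointwise(1)[OF assms(4,1)])
  note intros = smooth_in_chart_sum[OF assms(1,2)] smooth_in_chart_mult[OF assms(1,2)] inv
    smooth_cov_deriv[OF assms]
  show "smooth_in_chart c U (\<lambda>p. trace_last2 \<Gamma> g c p i)"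
    unfolding trace_last2_def by (intro intros)
  show "smooth_in_chart c U (\<lambda>p. trace_first2 \<Gamma> g c p i)"
    unfolding trace_first2_def by (intro intros)
qed

text \<open>The inhomogeneous terms in the transformation of the Christoffel symbols cancel against those
  produced by differentiating the Jacobians in the transformation law of \<open>g\<close>.\<close>

lemma cov_deriv_transform:
  assumes "c \<in> A" "d \<in> A" "openin M U" "p \<in> U \<inter> fst c \<inter> fst d"
    and \<Gamma>: "connection_on A U \<Gamma>" and g: "metric_on A U g"
  shows "cov_deriv \<Gamma> g c p i j k = (\<Sum>a\<in>UNIV. \<Sum>b\<in>UNIV. \<Sum>e\<in>UNIV.
      jac c d a i p * jac c d b j p * jac c d e k p * cov_deriv \<Gamma> g d p a b e)"
proof -
  let ?J = "\<lambda>a i. jac c d a i p" and ?D = "\<lambda>i a j. coord_deriv c i (jac c d a j) p"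
  let ?G = "\<lambda>b e. g d p $ b $ e" and ?dG = "\<lambda>a b e. coord_deriv d a (\<lambda>q. g d q $ b $ e) p"
  have pc: "p \<in> fst c" "p \<in> U \<inter> fst d \<inter> fst c" "p \<in> fst d \<inter> fst c" "p \<in> fst c \<inter> fst d"
    "p \<in> U \<inter> fst d" using assms(4) by auto
  \<comment> \<open>The transformation law of \<open>g\<close> holds only over the overlap with
    \<open>d\<close>, so it is differentiated on \<open>U \<inter> fst d\<close>, which is still
    open.\<close>
  have Udop: "openin M (U \<inter> fst d)" using assms(3) chart_dom_open[OF assms(2)] by (rule openin_Int)
  have gtr: "g c q $ i $ j = (\<Sum>b\<in>UNIV. \<Sum>e\<in>UNIV. jac c d b i q * jac c d e j q * g d q $ b $ e)"
    if "q \<in> U \<inter> fst d \<inter> fst c" for q i j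
    by (rule metric_on_transform[OF g assms(1,2)]) (use that in auto)
  note \<Gamma>tr = connection_on_transform[OF \<Gamma> assms(1,2,4)]
  have dJ: "diff_in_chart c (jac c d a i) p" for a i
    by (rule smooth_in_chart_imp_diff[OF jac_smooth[OF assms(1,2)] pc(3)])
  have dgd: "diff_in_chart d (\<lambda>q. g d q $ b $ e) p" for b e
    by (rule smooth_in_chart_imp_diff[OF metric_on_smooth[OF g assms(2)] pc(5)])
  note dgc = coord_deriv_chain[OF assms(1,2) pc(4) dgd]
  note mult = coord_deriv_mult[OF assms(1) pc(1)]
  have "coord_deriv c i (\<lambda>q. g c q $ j $ k) p =
      coord_deriv c i (\<lambda>q. \<Sum>b\<in>UNIV. \<Sum>e\<in>UNIV. jac c d b j q * jac c d e k q * g d q $ b $ e) p"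
    by (rule coord_deriv_cong[OF assms(1) Udop pc(2) gtr])
  also have "\<dots> = (\<Sum>b\<in>UNIV. \<Sum>e\<in>UNIV. (?D i b j * ?J e k + ?J b j * ?D i e k) * ?G b e
      + ?J b j * ?J e k * (\<Sum>a\<in>UNIV. ?J a i * ?dG a b e))"
    by (simp add: coord_deriv_sum mult dJ dgc)
  finally have 1: "coord_deriv c i (\<lambda>q. g c q $ j $ k) p = \<dots>" .
  have "(\<Sum>m\<in>UNIV. \<Gamma> c p $ m $ i $ j * g c p $ m $ k) =
      (\<Sum>m\<in>UNIV. \<Sum>b\<in>UNIV. \<Sum>e\<in>UNIV. ?J b m * \<Gamma> c p $ m $ i $ j * (?J e k * ?G b e))"
    unfolding gtr[OF pc(2)] sum_distrib_left by (simp add: mult_ac)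
  also have "\<dots> = (\<Sum>b\<in>UNIV. \<Sum>e\<in>UNIV. \<Sum>m\<in>UNIV. ?J b m * \<Gamma> c p $ m $ i $ j * (?J e k * ?G b e))"
    by (rule sum_move_3[symmetric])
  also have "\<dots> = (\<Sum>b\<in>UNIV. \<Sum>e\<in>UNIV.
      ((\<Sum>a\<in>UNIV. \<Sum>f\<in>UNIV. ?J a i * ?J f j * \<Gamma> d p $ b $ a $ f) + ?D i b j) * (?J e k * ?G b e))"
    unfolding sum_distrib_right[symmetric] \<Gamma>tr ..
  finally have 2: "(\<Sum>m\<in>UNIV. \<Gamma> c p $ m $ i $ j * g c p $ m $ k) = \<dots>" .
  have "(\<Sum>m\<in>UNIV. \<Gamma> c p $ m $ i $ k * g c p $ j $ m) =
      (\<Sum>m\<in>UNIV. \<Sum>b\<in>UNIV. \<Sum>e\<in>UNIV. ?J e m * \<Gamma> c p $ m $ i $ k * (?J b j * ?G b e))"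
    unfolding gtr[OF pc(2)] sum_distrib_left by (simp add: mult_ac)
  also have "\<dots> = (\<Sum>b\<in>UNIV. \<Sum>e\<in>UNIV. \<Sum>m\<in>UNIV. ?J e m * \<Gamma> c p $ m $ i $ k * (?J b j * ?G b e))"
    by (rule sum_move_3[symmetric])
  also have "\<dots> = (\<Sum>b\<in>UNIV. \<Sum>e\<in>UNIV.
      ((\<Sum>a\<in>UNIV. \<Sum>f\<in>UNIV. ?J a i * ?J f k * \<Gamma> d p $ e $ a $ f) + ?D i e k) * (?J b j * ?G b e))"
    unfolding sum_distrib_right[symmetric] \<Gamma>tr ..
  finally have 3: "(\<Sum>m\<in>UNIV. \<Gamma> c p $ m $ i $ k * g c p $ j $ m) = \<dots>" .
  have 4: "cov_deriv \<Gamma> g c p i j k =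
      (\<Sum>b\<in>UNIV. \<Sum>e\<in>UNIV. ?J b j * ?J e k * (\<Sum>a\<in>UNIV. ?J a i * ?dG a b e))
      - (\<Sum>b\<in>UNIV. \<Sum>e\<in>UNIV. (\<Sum>a\<in>UNIV. \<Sum>f\<in>UNIV. ?J a i * ?J f j * \<Gamma> d p $ b $ a $ f) * (?J e k * ?G b e))
      - (\<Sum>b\<in>UNIV. \<Sum>e\<in>UNIV. (\<Sum>a\<in>UNIV. \<Sum>f\<in>UNIV. ?J a i * ?J f k * \<Gamma> d p $ e $ a $ f) * (?J b j * ?G b e))"
    unfolding cov_deriv_def[of \<Gamma> g c] 1 2 3 sum_subtractf[symmetric]
    by (intro sum.cong refl) (simp add: algebra_simps)
  \<comment> \<open>The three remaining sums are brought to the form of three Jacobians times one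
    term of \<open>nabla g\<close> in the chart \<open>d\<close>, so that they reassemble into the
    claim.\<close>
  have 5: "(\<Sum>b\<in>UNIV. \<Sum>e\<in>UNIV. ?J b j * ?J e k * (\<Sum>a\<in>UNIV. ?J a i * ?dG a b e)) =
      (\<Sum>a\<in>UNIV. \<Sum>b\<in>UNIV. \<Sum>e\<in>UNIV. ?J a i * ?J b j * ?J e k * ?dG a b e)"
  proof -
    have "(\<Sum>b\<in>UNIV. \<Sum>e\<in>UNIV. ?J b j * ?J e k * (\<Sum>a\<in>UNIV. ?J a i * ?dG a b e)) =
        (\<Sum>b\<in>UNIV. \<Sum>e\<in>UNIV. \<Sum>a\<in>UNIV. ?J a i * ?J b j * ?J e k * ?dG a b e)"
      unfolding sum_distrib_left by (simp add: mult_ac)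
    also have "\<dots> = (\<Sum>a\<in>UNIV. \<Sum>b\<in>UNIV. \<Sum>e\<in>UNIV. ?J a i * ?J b j * ?J e k * ?dG a b e)"
      by (rule sum_move_3)
    finally show ?thesis .
  qed
  have 6: "(\<Sum>b\<in>UNIV. \<Sum>e\<in>UNIV. (\<Sum>a\<in>UNIV. \<Sum>f\<in>UNIV. ?J a i * ?J f j * \<Gamma> d p $ b $ a $ f) * (?J e k * ?G b e)) =
      (\<Sum>a\<in>UNIV. \<Sum>b\<in>UNIV. \<Sum>e\<in>UNIV. ?J a i * ?J b j * ?J e k * (\<Sum>m\<in>UNIV. \<Gamma> d p $ m $ a $ b * ?G m e))"
  proof -
    have "(\<Sum>m\<in>UNIV. \<Sum>e\<in>UNIV. (\<Sum>a\<in>UNIV. \<Sum>b\<in>UNIV. ?J a i * ?J b j * \<Gamma> d p $ m $ a $ b) * (?J e k * ?G m e)) =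
      (\<Sum>a\<in>UNIV. \<Sum>b\<in>UNIV. \<Sum>m\<in>UNIV. \<Sum>e\<in>UNIV. ?J a i * ?J b j * \<Gamma> d p $ m $ a $ b * (?J e k * ?G m e))"
      unfolding sum_distrib_right by (rule sum_swap_pairs)
    also have "\<dots> = (\<Sum>a\<in>UNIV. \<Sum>b\<in>UNIV. \<Sum>e\<in>UNIV. \<Sum>m\<in>UNIV. ?J a i * ?J b j * \<Gamma> d p $ m $ a $ b * (?J e k * ?G m e))"
      by (rule sum.cong[OF refl], rule sum.cong[OF refl], rule sum.swap)
    also have "\<dots> = (\<Sum>a\<in>UNIV. \<Sum>b\<in>UNIV. \<Sum>e\<in>UNIV. ?J a i * ?J b j * ?J e k * (\<Sum>m\<in>UNIV. \<Gamma> d p $ m $ a $ b * ?G m e))"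
      unfolding sum_distrib_left by (simp add: mult_ac)
    finally show ?thesis .
  qed
  have 7: "(\<Sum>b\<in>UNIV. \<Sum>e\<in>UNIV. (\<Sum>a\<in>UNIV. \<Sum>f\<in>UNIV. ?J a i * ?J f k * \<Gamma> d p $ e $ a $ f) * (?J b j * ?G b e)) =
      (\<Sum>a\<in>UNIV. \<Sum>b\<in>UNIV. \<Sum>e\<in>UNIV. ?J a i * ?J b j * ?J e k * (\<Sum>m\<in>UNIV. \<Gamma> d p $ m $ a $ e * ?G b m))"
  proof -
    have "(\<Sum>b\<in>UNIV. \<Sum>m\<in>UNIV. (\<Sum>a\<in>UNIV. \<Sum>e\<in>UNIV. ?J a i * ?J e k * \<Gamma> d p $ m $ a $ e) * (?J b j * ?G b m)) =
      (\<Sum>a\<in>UNIV. \<Sum>e\<in>UNIV. \<Sum>b\<in>UNIV. \<Sum>m\<in>UNIV. ?J a i * ?J e k * \<Gamma> d p $ m $ a $ e * (?J b j * ?G b m))"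
      unfolding sum_distrib_right by (rule sum_swap_pairs)
    also have "\<dots> = (\<Sum>a\<in>UNIV. \<Sum>b\<in>UNIV. \<Sum>e\<in>UNIV. \<Sum>m\<in>UNIV. ?J a i * ?J e k * \<Gamma> d p $ m $ a $ e * (?J b j * ?G b m))"
      by (rule sum.cong[OF refl], rule sum.swap)
    also have "\<dots> = (\<Sum>a\<in>UNIV. \<Sum>b\<in>UNIV. \<Sum>e\<in>UNIV. ?J a i * ?J b j * ?J e k * (\<Sum>m\<in>UNIV. \<Gamma> d p $ m $ a $ e * ?G b m))"
      unfolding sum_distrib_left by (simp add: mult_ac)
    finally show ?thesis .
  qed
  show ?thesis
    unfolding 4 5 6 7 sum_subtractf[symmetric] cov_deriv_def[of \<Gamma> g d]
    by (simp add: right_diff_distrib)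
qed

text \<open>The contravariant law of the inverse metric, in the form that uses only the Jacobian
  from \<open>c\<close> to \<open>d\<close>: as \<open>g_c = J^T g_d J\<close>, the matrix
  \<open>J g_c^-1 J^T\<close> is inverse to \<open>g_d\<close>.\<close>

lemma matrix_inv_transform:
  assumes "c \<in> A" "d \<in> A" "p \<in> U \<inter> fst c \<inter> fst d" "metric_on A U g"
  shows "(\<Sum>p'\<in>UNIV. \<Sum>q'\<in>UNIV. jac c d a p' p * jac c d b q' p * matrix_inv (g c p) $ p' $ q') =
    matrix_inv (g d p) $ a $ b"
proof -
  define J where "J = (\<chi> a i. jac c d a i p)"
  let ?H = "matrix_inv (g c p)"
  have p: "p \<in> U \<inter> fst c" using assms(3) by blast
  have "g c p = transpose J ** (g d p ** J)"
    using metric_on_transform[OF assms(4,1,2,3)]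
    by (simp add: vec_eq_iff matrix_matrix_mult_def transpose_def J_def sum_distrib_left mult_ac)
  then have "transpose J ** (g d p ** J ** ?H) = mat 1"
    using matrix_inv_mult(1)[OF metric_on_pointwise(1)[OF assms(4,1) p]]
    by (simp add: matrix_mul_assoc)
  \<comment> \<open>A one-sided inverse of a square matrix is two-sided, so
    \<open>transpose J\<close> may move from the left end of the product to the right end.\<close>
  then have "g d p ** J ** ?H ** transpose J = mat 1"
    using matrix_left_right_inverse by blast
  then have "matrix_inv (g d p) = J ** (?H ** transpose J)"
    by (intro matrix_inv_eqI) (simp add: matrix_mul_assoc)
  then show ?thesis
    by (simp add: matrix_matrix_mult_def transpose_def J_def sum_distrib_left mult_ac)
qed

text \<open>Contraction with the inverse metric absorbs two of the three Jacobians in the law of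
  \<open>nabla g\<close>. The one left over belongs to the free index, so both traces transform as
  one-forms.\<close>

lemma trace_transform:
  assumes "c \<in> A" "d \<in> A" "openin M U" "p \<in> U \<inter> fst c \<inter> fst d"
    and \<Gamma>: "connection_on A U \<Gamma>" and g: "metric_on A U g"
  shows "trace_last2 \<Gamma> g c p i = (\<Sum>a\<in>UNIV. jac c d a i p * trace_last2 \<Gamma> g d p a)"
    and "trace_first2 \<Gamma> g c p i = (\<Sum>a\<in>UNIV. jac c d a i p * trace_first2 \<Gamma> g d p a)"
proof -
  let ?J = "\<lambda>a i. jac c d a i p" and ?H = "\<lambda>c. matrix_inv (g c p)"
  have contract: "(\<Sum>x\<in>UNIV. \<Sum>y\<in>UNIV. ?H c $ x $ y * (\<Sum>b\<in>UNIV. \<Sum>e\<in>UNIV. ?J b x * ?J e y * T b e)) =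
      (\<Sum>b\<in>UNIV. \<Sum>e\<in>UNIV. ?H d $ b $ e * T b e)" for T :: "'n \<Rightarrow> 'n \<Rightarrow> real"
  proof -
    have "(\<Sum>x\<in>UNIV. \<Sum>y\<in>UNIV. ?H c $ x $ y * (\<Sum>b\<in>UNIV. \<Sum>e\<in>UNIV. ?J b x * ?J e y * T b e)) =
      (\<Sum>x\<in>UNIV. \<Sum>y\<in>UNIV. \<Sum>b\<in>UNIV. \<Sum>e\<in>UNIV. ?J b x * ?J e y * ?H c $ x $ y * T b e)"
      unfolding sum_distrib_left by (simp add: mult_ac)
    also have "\<dots> = (\<Sum>b\<in>UNIV. \<Sum>e\<in>UNIV. \<Sum>x\<in>UNIV. \<Sum>y\<in>UNIV. ?J b x * ?J e y * ?H c $ x $ y * T b e)"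
      by (rule sum_swap_pairs)
    also have "\<dots> = (\<Sum>b\<in>UNIV. \<Sum>e\<in>UNIV. ?H d $ b $ e * T b e)"
      unfolding sum_distrib_right[symmetric] matrix_inv_transform[OF assms(1,2,4) g] ..
    finally show ?thesis .
  qed
  \<comment> \<open>The sum over the free index \<open>a\<close> is pulled outside, where
    \<open>contract\<close> applies for each fixed \<open>a\<close>.\<close>
  have contract_lin: "(\<Sum>x\<in>UNIV. \<Sum>y\<in>UNIV. ?H c $ x $ y *
        (\<Sum>a\<in>UNIV. ?J a i * (\<Sum>b\<in>UNIV. \<Sum>e\<in>UNIV. ?J b x * ?J e y * T a b e))) =
      (\<Sum>a\<in>UNIV. ?J a i * (\<Sum>b\<in>UNIV. \<Sum>e\<in>UNIV. ?H d $ b $ e * T a b e))"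
    for T :: "'n \<Rightarrow> 'n \<Rightarrow> 'n \<Rightarrow> real"
  proof -
    let ?S = "\<lambda>a x y. \<Sum>b\<in>UNIV. \<Sum>e\<in>UNIV. ?J b x * ?J e y * T a b e"
    have "(\<Sum>x\<in>UNIV. \<Sum>y\<in>UNIV. ?H c $ x $ y * (\<Sum>a\<in>UNIV. ?J a i * ?S a x y)) =
        (\<Sum>x\<in>UNIV. \<Sum>y\<in>UNIV. \<Sum>a\<in>UNIV. ?J a i * (?H c $ x $ y * ?S a x y))"
      unfolding sum_distrib_left[where A = UNIV and r = "?H c $ _ $ _" and f = "\<lambda>a. ?J a i * ?S a _ _"]
      by (simp only: mult.left_commute)
    also have "\<dots> = (\<Sum>a\<in>UNIV. \<Sum>x\<in>UNIV. \<Sum>y\<in>UNIV. ?J a i * (?H c $ x $ y * ?S a x y))"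
      by (rule sum_move_3)
    also have "\<dots> = (\<Sum>a\<in>UNIV. ?J a i * (\<Sum>x\<in>UNIV. \<Sum>y\<in>UNIV. ?H c $ x $ y * ?S a x y))"
      by (simp only: sum_distrib_left[symmetric])
    also have "\<dots> = (\<Sum>a\<in>UNIV. ?J a i * (\<Sum>b\<in>UNIV. \<Sum>e\<in>UNIV. ?H d $ b $ e * T a b e))"
      by (simp only: contract)
    finally show ?thesis .
  qed
  note T = cov_deriv_transform[OF assms]
  have "cov_deriv \<Gamma> g c p i x y = (\<Sum>a\<in>UNIV. ?J a i *
      (\<Sum>b\<in>UNIV. \<Sum>e\<in>UNIV. ?J b x * ?J e y * cov_deriv \<Gamma> g d p a b e))" for x y
    unfolding T sum_distrib_left by (simp add: mult_ac)
  then show "trace_last2 \<Gamma> g c p i = (\<Sum>a\<in>UNIV. ?J a i * trace_last2 \<Gamma> g d p a)"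
    unfolding trace_last2_def by (simp only: contract_lin)
  \<comment> \<open>Here the free index is the last one, so its sum is moved to the front to match
    \<open>contract_lin\<close>.\<close>
  have "cov_deriv \<Gamma> g c p x y i = (\<Sum>a\<in>UNIV. ?J a i *
      (\<Sum>b\<in>UNIV. \<Sum>e\<in>UNIV. ?J b x * ?J e y * cov_deriv \<Gamma> g d p b e a))" for x y
  proof -
    have "cov_deriv \<Gamma> g c p x y i = (\<Sum>a\<in>UNIV. \<Sum>b\<in>UNIV. \<Sum>e\<in>UNIV.
        ?J e i * (?J a x * ?J b y * cov_deriv \<Gamma> g d p a b e))"
      unfolding T by (simp add: mult_ac)
    also have "\<dots> = (\<Sum>e\<in>UNIV. \<Sum>a\<in>UNIV. \<Sum>b\<in>UNIV.
        ?J e i * (?J a x * ?J b y * cov_deriv \<Gamma> g d p a b e))"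
      by (rule sum_move_3)
    finally show ?thesis by (simp only: sum_distrib_left[symmetric])
  qed
  then show "trace_first2 \<Gamma> g c p i = (\<Sum>a\<in>UNIV. ?J a i * trace_first2 \<Gamma> g d p a)"
    unfolding trace_first2_def by (simp only: contract_lin)
qed

text \<open>One choice of \<alpha> and \<beta> gives the one-form leading to the aligned
  representative, another the one-form of the AH condition. The value \<open>0\<close> elsewhere is
  what \<open>supported_on\<close> demands.\<close>

lemma oneform_on_traces:
  assumes "openin M U" "connection_on A U \<Gamma>" "metric_on A U g"
  shows "oneform_on A U (\<lambda>c p. if c \<in> A \<and> p \<in> U \<inter> fst c
     then \<chi> i. \<alpha> * trace_last2 \<Gamma> g c p i + \<beta> * trace_first2 \<Gamma> g c p i else 0)"
  unfolding oneform_on_def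
proof (intro conjI ballI allI)
  fix c i assume c: "c \<in> A"
  have "smooth_in_chart c U (\<lambda>p. \<alpha> * trace_last2 \<Gamma> g c p i + \<beta> * trace_first2 \<Gamma> g c p i)"
    by (intro smooth_in_chart_add[OF c assms(1)] smooth_in_chart_mult[OF c assms(1)]
        smooth_in_chart_const smooth_traces[OF c assms])
  then show "smooth_in_chart c U (\<lambda>p. (if c \<in> A \<and> p \<in> U \<inter> fst c
     then \<chi> i. \<alpha> * trace_last2 \<Gamma> g c p i + \<beta> * trace_first2 \<Gamma> g c p i else 0) $ i)"
    by (rule smooth_in_chart_cong[OF c assms(1), rotated]) (use c in auto)
next
  fix c d p i assume c: "c \<in> A" and d: "d \<in> A" and p: "p \<in> U \<inter> fst c \<inter> fst d"
  show "(if c \<in> A \<and> p \<in> U \<inter> fst c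
     then \<chi> i. \<alpha> * trace_last2 \<Gamma> g c p i + \<beta> * trace_first2 \<Gamma> g c p i else 0) $ i =
     (\<Sum>a\<in>UNIV. jac c d a i p * (if d \<in> A \<and> p \<in> U \<inter> fst d
     then \<chi> i. \<alpha> * trace_last2 \<Gamma> g d p i + \<beta> * trace_first2 \<Gamma> g d p i else 0) $ a)"
    using c d p trace_transform[OF c d assms(1) p assms(2,3), of i]
    by (simp add: sum_distrib_left sum.distrib distrib_left mult_ac)
qed (auto simp: supported_on_def)

end

section \<open>Projective and conformal changes of the structures\<close>

definition projective_shift ::
    "('a, 'n::finite) oneform \<Rightarrow> ('a, 'n) connection \<Rightarrow> ('a, 'n) connection" where
  "projective_shift \<sigma> \<Gamma> c p =
     \<Gamma> c p + (\<chi> k i j. 2 * sym2 (\<lambda>i j. \<sigma> c p $ i * of_bool (j = k)) i j)"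

lemma projective_shift_component:
  "projective_shift \<sigma> \<Gamma> c p $ k $ i $ j =
     \<Gamma> c p $ k $ i $ j + 2 * sym2 (\<lambda>i j. \<sigma> c p $ i * of_bool (j = k)) i j"
  by (simp add: projective_shift_def)

lemma projective_structure_cases:
  assumes "projective_structure A U P"
  obtains B where "torsion_free_connection_on A U B" "P = projective_rel A U `` {B}"
  using assms unfolding projective_structure_def by (elim quotientE) auto

lemma conformal_structure_cases:
  assumes "conformal_structure A U G"
  obtains h where "metric_on A U h" "G = conformal_rel A U `` {h}"
  using assms unfolding conformal_structure_def by (elim quotientE) auto

lemma restrict_field_id: "supported_on A U T \<Longrightarrow> restrict_field U T = T"
  by (auto simp: restrict_field_def supported_on_def fun_eq_iff)

text \<open>The normalisation to \<open>0\<close> off the domain makes fields extensional; this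
  turns equality of components into uniqueness of the aligned connection.\<close>

lemma supported_on_eqI:
  assumes "supported_on A U S" "supported_on A U T"
    and "\<And>c p. c \<in> A \<Longrightarrow> p \<in> U \<inter> fst c \<Longrightarrow> S c p = T c p"
  shows "S = T"
proof (intro ext)
  fix c p
  show "S c p = T c p"
  proof (cases "c \<in> A \<and> p \<in> U \<inter> fst c")
    case False
    then have "S c p = 0" "T c p = 0" using assms(1,2) unfolding supported_on_def by blast+
    then show ?thesis by simp
  qed (use assms(3) in blast)
qed

context smooth_mfd
begin

lemma oneform_on_zero: "oneform_on A U (\<lambda>c p. 0)"
  using smooth_in_chart_const by (auto simp: oneform_on_def supported_on_def)

lemma oneform_on_add:
  assumes "openin M U" "oneform_on A U \<sigma>" "oneform_on A U \<tau>"
  shows "oneform_on A U (\<lambda>c p. \<sigma> c p + \<tau> c p)"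
  unfolding oneform_on_def
proof (intro conjI ballI allI)
  fix c i assume c: "c \<in> A"
  show "smooth_in_chart c U (\<lambda>p. (\<sigma> c p + \<tau> c p) $ i)"
    unfolding vector_add_component
    by (intro smooth_in_chart_add[OF c assms(1)]) (use assms c in \<open>auto simp: oneform_on_def\<close>)
next
  fix c d p i assume "c \<in> A" "d \<in> A" "p \<in> U \<inter> fst c \<inter> fst d"
  then have "\<sigma> c p $ i = (\<Sum>a\<in>UNIV. jac c d a i p * \<sigma> d p $ a)"
    "\<tau> c p $ i = (\<Sum>a\<in>UNIV. jac c d a i p * \<tau> d p $ a)"
    using assms unfolding oneform_on_def by blast+
  then show "(\<sigma> c p + \<tau> c p) $ i = (\<Sum>a\<in>UNIV. jac c d a i p * (\<sigma> d p + \<tau> d p) $ a)"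
    by (simp add: distrib_left sum.distrib)
qed (use assms in \<open>auto simp: oneform_on_def supported_on_def\<close>)

text \<open>The added term is built from a one-form and the identity, hence is a tensor: both sides
  of the connection law gain \<open>\<sigma>_i J^m_j + \<sigma>_j J^m_i\<close>, and the
  inhomogeneous second derivative is untouched.\<close>

lemma torsion_free_projective_shift:
  assumes "openin M U" "torsion_free_connection_on A U \<Gamma>" "oneform_on A U \<sigma>"
  shows "torsion_free_connection_on A U (projective_shift \<sigma> \<Gamma>)"
  unfolding torsion_free_connection_on_def connection_on_def
proof (intro conjI ballI allI)
  have con: "connection_on A U \<Gamma>" using assms by (simp add: torsion_free_connection_on_def)
  show "supported_on A U (projective_shift \<sigma> \<Gamma>)"
    using con assms(3) unfolding connection_on_def oneform_on_def supported_on_def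
    by (simp add: vec_eq_iff projective_shift_component sym2_def)
  {
    fix c k i j assume c: "c \<in> A"
    have \<sigma>: "smooth_in_chart c U (\<lambda>p. \<sigma> c p $ i)" for i using assms(3) c by (simp add: oneform_on_def)
    have "smooth_in_chart c U (\<lambda>p. \<Gamma> c p $ k $ i $ j
        + (\<sigma> c p $ i * of_bool (j = k) + \<sigma> c p $ j * of_bool (i = k)))"
      by (intro smooth_in_chart_add[OF c assms(1)] smooth_in_chart_mult[OF c assms(1)]
          smooth_in_chart_const connection_on_smooth[OF con c] \<sigma>)
    moreover have "2 * sym2 (\<lambda>i j. \<sigma> c p $ i * of_bool (j = k)) i j =
        \<sigma> c p $ i * of_bool (j = k) + \<sigma> c p $ j * of_bool (i = k)" for p
      by (simp add: sym2_def)
    ultimately show "smooth_in_chart c U (\<lambda>p. projective_shift \<sigma> \<Gamma> c p $ k $ i $ j)"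
      by (simp only: projective_shift_component)
  next
    fix c d p m i j assume c: "c \<in> A" and d: "d \<in> A" and p: "p \<in> U \<inter> fst c \<inter> fst d"
    let ?J = "\<lambda>a i. jac c d a i p"
    have \<sigma>: "\<sigma> c p $ i = (\<Sum>a\<in>UNIV. ?J a i * \<sigma> d p $ a)" for i
      using assms(3) c d p unfolding oneform_on_def by blast
    have "(\<Sum>k\<in>UNIV. ?J m k * projective_shift \<sigma> \<Gamma> c p $ k $ i $ j) =
        (\<Sum>k\<in>UNIV. ?J m k * \<Gamma> c p $ k $ i $ j) + \<sigma> c p $ i * ?J m j + \<sigma> c p $ j * ?J m i"
    proof -
      have "?J m k * projective_shift \<sigma> \<Gamma> c p $ k $ i $ j = ?J m k * \<Gamma> c p $ k $ i $ j
          + \<sigma> c p $ i * (of_bool (j = k) * ?J m k) + \<sigma> c p $ j * (of_bool (i = k) * ?J m k)" for k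
        by (simp add: projective_shift_component sym2_def algebra_simps)
      then show ?thesis by (simp add: sum.distrib sum_distrib_left[symmetric])
    qed
    moreover have "(\<Sum>a\<in>UNIV. \<Sum>b\<in>UNIV. ?J a i * ?J b j * projective_shift \<sigma> \<Gamma> d p $ m $ a $ b) =
        (\<Sum>a\<in>UNIV. \<Sum>b\<in>UNIV. ?J a i * ?J b j * \<Gamma> d p $ m $ a $ b)
        + \<sigma> c p $ i * ?J m j + \<sigma> c p $ j * ?J m i"
    proof -
      have "?J a i * ?J b j * projective_shift \<sigma> \<Gamma> d p $ m $ a $ b = ?J a i * ?J b j * \<Gamma> d p $ m $ a $ b
          + ?J a i * \<sigma> d p $ a * (of_bool (b = m) * ?J b j) + of_bool (a = m) * ?J a i * (?J b j * \<sigma> d p $ b)"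
        for a b
        by (simp add: projective_shift_component sym2_def algebra_simps)
      then show ?thesis
        by (simp add: sum.distrib sum_distrib_left[symmetric] sum_distrib_right[symmetric] \<sigma>[symmetric])
    qed
    ultimately show "(\<Sum>k\<in>UNIV. ?J m k * projective_shift \<sigma> \<Gamma> c p $ k $ i $ j) =
        (\<Sum>a\<in>UNIV. \<Sum>b\<in>UNIV. ?J a i * ?J b j * projective_shift \<sigma> \<Gamma> d p $ m $ a $ b)
        + coord_deriv c i (jac c d m j) p"
      using connection_on_transform[OF con c d p, of m i j] by simp
  next
    fix c p k i j assume "c \<in> A" "p \<in> U \<inter> fst c"
    then have "\<Gamma> c p $ k $ i $ j = \<Gamma> c p $ k $ j $ i"
      using assms(2) unfolding torsion_free_connection_on_def by blast
    then show "projective_shift \<sigma> \<Gamma> c p $ k $ i $ j = projective_shift \<sigma> \<Gamma> c p $ k $ j $ i"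
      by (simp add: projective_shift_component sym2_def add.commute)
  }
qed

lemma projective_rel_shift:
  assumes "openin M U" "torsion_free_connection_on A U \<Gamma>" "oneform_on A U \<sigma>"
  shows "(\<Gamma>, projective_shift \<sigma> \<Gamma>) \<in> projective_rel A U"
  using assms(2,3) torsion_free_projective_shift[OF assms]
  by (auto simp: projective_rel_def projective_shift_component intro!: exI[of _ \<sigma>])

section \<open>Conformal changes and the aligned representative\<close>

lemma cov_deriv_conformal:
  assumes "c \<in> A" "openin M U" "p \<in> U \<inter> fst c"
    and g': "\<And>q. q \<in> U \<inter> fst c \<Longrightarrow> g' c q = f q *\<^sub>R g c q"
    and diff: "diff_in_chart c f p" "\<And>j k. diff_in_chart c (\<lambda>q. g c q $ j $ k) p"
  shows "cov_deriv \<Gamma> g' c p i j k = f p * cov_deriv \<Gamma> g c p i j k + coord_deriv c i f p * g c p $ j $ k"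
proof -
  have "coord_deriv c i (\<lambda>q. g' c q $ j $ k) p = coord_deriv c i (\<lambda>q. f q * g c q $ j $ k) p"
    by (rule coord_deriv_cong[OF assms(1-3)]) (simp add: g')
  also have "\<dots> = coord_deriv c i f p * g c p $ j $ k + f p * coord_deriv c i (\<lambda>q. g c q $ j $ k) p"
    using assms(1,3) diff by (intro coord_deriv_mult) auto
  finally show ?thesis
    unfolding cov_deriv_def g'[OF assms(3)] by (simp add: algebra_simps sum_distrib_left)
qed

lemma cov_deriv_symmetric:
  assumes "openin M U" "metric_on A U g" "c \<in> A" "p \<in> U \<inter> fst c"
  shows "cov_deriv \<Gamma> g c p i j k = cov_deriv \<Gamma> g c p i k j"
proof -
  have "coord_deriv c i (\<lambda>q. g c q $ j $ k) p = coord_deriv c i (\<lambda>q. g c q $ k $ j) p"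
    using metric_on_pointwise(3)[OF assms(2,3)] by (intro coord_deriv_cong[OF assms(3,1,4)])
  then show ?thesis
    unfolding cov_deriv_def using metric_on_pointwise(3)[OF assms(2-4), of _ j]
      metric_on_pointwise(3)[OF assms(2-4), of _ k] by simp
qed

lemma trace_conformal:
  assumes "c \<in> A" "openin M U" "p \<in> U \<inter> fst c" and g: "metric_on A U g"
    and g': "\<And>q. q \<in> U \<inter> fst c \<Longrightarrow> g' c q = f q *\<^sub>R g c q"
    and f: "smooth_in_chart c U f" "f p \<noteq> 0"
  shows "trace_last2 \<Gamma> g' c p i = trace_last2 \<Gamma> g c p i + real CARD('n) * (coord_deriv c i f p / f p)"
    and "trace_first2 \<Gamma> g' c p i = trace_first2 \<Gamma> g c p i + coord_deriv c i f p / f p"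
proof -
  note m = metric_on_pointwise[OF g assms(1,3)]
  note t = trace_metric[OF m(1,2)]
  let ?s = "\<lambda>i. coord_deriv c i f p / f p"
  have inv: "matrix_inv (g' c p) = inverse (f p) *\<^sub>R matrix_inv (g c p)"
    unfolding g'[OF assms(3)] by (rule matrix_inv_scaleR[OF m(1) f(2)])
  \<comment> \<open>Factoring out \<open>f\<close> lets it cancel against the \<open>1/f\<close> of
    the inverse metric, leaving \<open>nabla g\<close> plus the product of \<open>df/f\<close> and
    \<open>g\<close>.\<close>
  have T: "cov_deriv \<Gamma> g' c p a b e = f p * (cov_deriv \<Gamma> g c p a b e + ?s a * g c p $ b $ e)" for a b e
    using f smooth_in_chart_imp_diff[OF f(1) assms(3)]
      smooth_in_chart_imp_diff[OF metric_on_smooth[OF g assms(1)] assms(3)]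
    by (subst cov_deriv_conformal[of c U p g' f g, OF assms(1-3) g']) (auto simp: field_simps)
  have H: "matrix_inv (g' c p) $ a $ b * (f p * x) = matrix_inv (g c p) $ a $ b * x" for a b x
    using f(2) by (simp add: inv)
  show "trace_last2 \<Gamma> g' c p i = trace_last2 \<Gamma> g c p i + real CARD('n) * ?s i"
    unfolding trace_last2_def T H distrib_left sum.distrib t(1) ..
  show "trace_first2 \<Gamma> g' c p i = trace_first2 \<Gamma> g c p i + ?s i"
    unfolding trace_first2_def T H distrib_left sum.distrib t(2) ..
qed

lemma conformal_rel_refl: "metric_on A U g \<Longrightarrow> (g, g) \<in> conformal_rel A U"
  using smooth_in_chart_const unfolding conformal_rel_def smooth_fun_def
  by (auto intro!: exI[of _ "\<lambda>_. 1"])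

text \<open>A conformal factor \<open>f\<close> adds \<open>n df/f\<close> to
  \<open>trace_last2\<close> and \<open>df/f\<close> to \<open>trace_first2\<close>. So
  \<open>trace_last2 - n trace_first2\<close> is the same for all metrics of the class, and one of
  them decides alignment.\<close>

lemma aligned_conformal_class:
  assumes "openin M U" "metric_on A U h"
  shows "aligned A U \<Gamma> (conformal_rel A U `` {h}) \<longleftrightarrow> (\<forall>c\<in>A. \<forall>x\<in>U \<inter> fst c. \<forall>i.
     trace_last2 \<Gamma> h c x i = real CARD('n) * trace_first2 \<Gamma> h c x i)"
proof -
  note hh = conformal_rel_refl[OF assms(2)]
  have "trace_last2 \<Gamma> g c x i = real CARD('n) * trace_first2 \<Gamma> g c x i \<longleftrightarrow>
      trace_last2 \<Gamma> h c x i = real CARD('n) * trace_first2 \<Gamma> h c x i"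
    if g: "(h, g) \<in> conformal_rel A U" and c: "c \<in> A" and x: "x \<in> U \<inter> fst c" for g c x i
  proof -
    obtain f where f: "smooth_fun A U f" "\<And>p. p \<in> U \<Longrightarrow> f p > 0"
      "\<And>c p. c \<in> A \<Longrightarrow> p \<in> U \<inter> fst c \<Longrightarrow> g c p = f p *\<^sub>R h c p"
      using g unfolding conformal_rel_def by blast
    have "smooth_in_chart c U f" "f x \<noteq> 0" using f(1) f(2)[of x] c x by (auto simp: smooth_fun_def)
    from trace_conformal[of c U x h g f, OF c assms(1) x assms(2) f(3)[OF c] this] show ?thesis
      by (simp add: distrib_left)
  qed
  then show ?thesis unfolding aligned_iff_trace using hh by blast
qed

text \<open>A projective change by \<open>\<sigma>\<close> subtracts \<open>(n + 2) (n - 1) \<sigma>\<close> from the defect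
  \<open>n g\<^sup>p\<^sup>q \<nabla>\<^sub>p g\<^sub>q\<^sub>i - g\<^sup>p\<^sup>q \<nabla>\<^sub>i g\<^sub>p\<^sub>q\<close> of alignment, so exactly one \<open>\<sigma>\<close> annihilates it.\<close>

lemma ex1_aligned_representative:
  assumes n: "CARD('n) \<ge> 2" and U: "openin M U"
    and P: "projective_structure A U P" and G: "conformal_structure A U G"
  shows "\<exists>!\<Gamma>. \<Gamma> \<in> P \<and> aligned A U \<Gamma> G"
proof -
  define n where "n = real CARD('n)"
  obtain B where B: "torsion_free_connection_on A U B" "P = projective_rel A U `` {B}"
    using P by (rule projective_structure_cases)
  obtain h where h: "metric_on A U h" "G = conformal_rel A U `` {h}"
    using G by (rule conformal_structure_cases)
  have con: "connection_on A U B" using B(1) by (simp add: torsion_free_connection_on_def)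
  have n2: "n \<ge> 2" using n by (simp add: n_def)
  \<comment> \<open>The dimension bound enters here, through the factor
    \<open>n - 1\<close>.\<close>
  then have K: "(n + 2) * (n - 1) \<noteq> 0" by simp
  define \<sigma> where "\<sigma> = (\<lambda>c p. if c \<in> A \<and> p \<in> U \<inter> fst c
     then \<chi> i. - 1 / ((n + 2) * (n - 1)) * trace_last2 B h c p i
       + n / ((n + 2) * (n - 1)) * trace_first2 B h c p i else 0)"
  have \<sigma>: "oneform_on A U \<sigma>" unfolding \<sigma>_def by (rule oneform_on_traces[OF U con h(1)])
  have shift: "trace_last2 \<Gamma> h c p i = n * trace_first2 \<Gamma> h c p i \<longleftrightarrow> s $ i = \<sigma> c p $ i"
    if "c \<in> A" "p \<in> U \<inter> fst c" "\<And>k i j. \<Gamma> c p $ k $ i $ j =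
      B c p $ k $ i $ j + 2 * sym2 (\<lambda>i j. s $ i * of_bool (j = k)) i j" for \<Gamma> c p s i
  proof -
    \<comment> \<open>The coefficient arises from the two trace formulas as
      \<open>n (n + 3) - (2 n + 2) = (n + 2) (n - 1)\<close>.\<close>
    have "trace_last2 \<Gamma> h c p i = n * trace_first2 \<Gamma> h c p i \<longleftrightarrow>
        (n + 2) * (n - 1) * s $ i = n * trace_first2 B h c p i - trace_last2 B h c p i"
      unfolding trace_projective_change[of A U h c p \<Gamma> B s, OF h(1) that] n_def[symmetric] by (auto simp: algebra_simps)
    also have "\<dots> \<longleftrightarrow> s $ i = (n * trace_first2 B h c p i - trace_last2 B h c p i) / ((n + 2) * (n - 1))"
      by (subst nonzero_eq_divide_eq[OF K]) (simp add: mult.commute)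
    also have "(n * trace_first2 B h c p i - trace_last2 B h c p i) / ((n + 2) * (n - 1)) = \<sigma> c p $ i"
      using that(1,2) by (simp add: \<sigma>_def diff_divide_distrib)
    finally show ?thesis .
  qed
  have al: "aligned A U \<Gamma> G \<longleftrightarrow> (\<forall>c\<in>A. \<forall>x\<in>U \<inter> fst c. \<forall>i.
     trace_last2 \<Gamma> h c x i = n * trace_first2 \<Gamma> h c x i)" for \<Gamma>
    unfolding h(2) n_def by (rule aligned_conformal_class[OF U h(1)])
  show ?thesis
  proof (rule ex1I[of _ "projective_shift \<sigma> B"])
    show "projective_shift \<sigma> B \<in> P \<and> aligned A U (projective_shift \<sigma> B) G"
      unfolding al B(2) using projective_rel_shift[OF U B(1) \<sigma>]
        shift[of _ _ "projective_shift \<sigma> B" "\<sigma> _ _", OF _ _ projective_shift_component] by blast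
    fix \<Gamma> assume "\<Gamma> \<in> P \<and> aligned A U \<Gamma> G"
    then have \<Gamma>: "(B, \<Gamma>) \<in> projective_rel A U" and a: "aligned A U \<Gamma> G" by (auto simp: B(2))
    obtain \<tau> where \<tau>: "\<And>c p k i j. c \<in> A \<Longrightarrow> p \<in> U \<inter> fst c \<Longrightarrow> \<Gamma> c p $ k $ i $ j =
      B c p $ k $ i $ j + 2 * sym2 (\<lambda>i j. \<tau> c p $ i * of_bool (j = k)) i j"
      using \<Gamma> unfolding projective_rel_def by blast
    show "\<Gamma> = projective_shift \<sigma> B"
    proof (rule supported_on_eqI)
      show "supported_on A U \<Gamma>" "supported_on A U (projective_shift \<sigma> B)"
        using \<Gamma> projective_rel_shift[OF U B(1) \<sigma>]
        by (auto simp: projective_rel_def torsion_free_connection_on_def connection_on_def)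
      fix c p assume c: "c \<in> A" and p: "p \<in> U \<inter> fst c"
      have "\<tau> c p $ i = \<sigma> c p $ i" for i
        using shift[of c p \<Gamma> "\<tau> c p", OF c p \<tau>[OF c p]] a[unfolded al] c p by blast
      then show "\<Gamma> c p = projective_shift \<sigma> B c p"
        by (simp add: vec_eq_iff \<tau>[OF c p] projective_shift_component)
    qed
  qed
qed

section \<open>The implications between the three conditions\<close>

lemma alt2_cov_deriv_trace:
  assumes "openin M U" "metric_on A U g" "c \<in> A" "p \<in> U \<inter> fst c"
    and v: "\<And>i j k. alt2 (\<lambda>i j. cov_deriv \<Gamma> g c p i j k) i j = alt2 (\<lambda>i j. v i * g c p $ j $ k) i j"
  shows "trace_last2 \<Gamma> g c p i - trace_first2 \<Gamma> g c p i = (real CARD('n) - 1) * v i"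
proof -
  note m = metric_on_pointwise[OF assms(2-4)]
  \<comment> \<open>Symmetry of \<open>nabla g\<close> in its last two indices puts the second term
    in the cyclic order \<open>j k i\<close>, so that contraction over \<open>j\<close> and
    \<open>k\<close> gives \<open>trace_first2\<close>. On the right it gives
    \<open>n v_i - v_i\<close>.\<close>
  have e: "cov_deriv \<Gamma> g c p i j k - cov_deriv \<Gamma> g c p j k i = v i * g c p $ j $ k - v j * g c p $ k $ i" for j k
    using v[of k i j] cov_deriv_symmetric[OF assms(1-4), of \<Gamma> j i k] m(3)[of i k]
    by (simp add: alt2_def)
  show ?thesis
    unfolding trace_last2_def trace_first2_def
    unfolding sum_subtractf[symmetric] right_diff_distrib[symmetric] e
    unfolding right_diff_distrib sum_subtractf trace_metric[OF m(1,2)]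
    by (simp add: algebra_simps)
qed

text \<open>The one-forms of successive projective changes add up, so shifting a member of the class
  of \<open>B\<close> stays in that class.\<close>

lemma projective_rel_shift_right:
  assumes "openin M U" "(B, \<Gamma>) \<in> projective_rel A U" "oneform_on A U \<omega>"
  shows "(B, projective_shift \<omega> \<Gamma>) \<in> projective_rel A U"
proof -
  obtain \<tau> where \<tau>: "oneform_on A U \<tau>" "\<And>c p k i j. c \<in> A \<Longrightarrow> p \<in> U \<inter> fst c \<Longrightarrow> \<Gamma> c p $ k $ i $ j =
    B c p $ k $ i $ j + 2 * sym2 (\<lambda>i j. \<tau> c p $ i * of_bool (j = k)) i j"
    and B: "torsion_free_connection_on A U B" and \<Gamma>: "torsion_free_connection_on A U \<Gamma>"
    using assms(2) unfolding projective_rel_def by blast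
  have "projective_shift \<omega> \<Gamma> c p $ k $ i $ j =
      B c p $ k $ i $ j + 2 * sym2 (\<lambda>i j. (\<tau> c p + \<omega> c p) $ i * of_bool (j = k)) i j"
    if "c \<in> A" "p \<in> U \<inter> fst c" for c p k i j
    by (simp add: projective_shift_component \<tau>(2)[OF that] sym2_def algebra_simps)
  then show ?thesis
    using B torsion_free_projective_shift[OF assms(1) \<Gamma> assms(3)] oneform_on_add[OF assms(1) \<tau>(1) assms(3)]
    unfolding projective_rel_def by blast
qed

lemma AH_imp_statistical:
  assumes P: "projective_structure A (topspace M) P" and G: "conformal_structure A (topspace M) G"
    and "\<Gamma> \<in> P" "AH_structure A (topspace M) \<Gamma> G" "g \<in> G"
  shows "\<exists>\<Gamma>\<in>P. statistical_structure A (topspace M) \<Gamma> g"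
proof -
  obtain B where B: "P = projective_rel A (topspace M) `` {B}"
    using P by (rule projective_structure_cases)
  obtain h where h: "G = conformal_rel A (topspace M) `` {h}"
    using G by (rule conformal_structure_cases)
  have g: "metric_on A (topspace M) g" using assms(5) by (auto simp: h conformal_rel_def)
  obtain \<omega> where \<omega>: "oneform_on A (topspace M) \<omega>"
    "\<And>c p i j k. c \<in> A \<Longrightarrow> p \<in> topspace M \<inter> fst c \<Longrightarrow>
      alt2 (\<lambda>i j. cov_deriv \<Gamma> g c p i j k) i j = alt2 (\<lambda>i j. \<omega> c p $ i * g c p $ j $ k) i j"
    using assms(4,5) unfolding AH_structure_def by blast
  have "torsion_free_connection_on A (topspace M) \<Gamma>" using assms(4) by (simp add: AH_structure_def)
  then have "torsion_free_connection_on A (topspace M) (projective_shift \<omega> \<Gamma>)"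
    by (rule torsion_free_projective_shift[OF openin_topspace _ \<omega>(1)])
  moreover have "alt2 (\<lambda>i j. cov_deriv (projective_shift \<omega> \<Gamma>) g c p i j k) i j = 0"
    if "c \<in> A" "p \<in> topspace M \<inter> fst c" for c p i j k
    by (subst alt2_cov_deriv_projective_change[of "projective_shift \<omega> \<Gamma>" c p \<Gamma> "\<omega> c p" g,
          OF projective_shift_component metric_on_pointwise(3)[OF g that]])
      (simp add: \<omega>(2)[OF that])
  ultimately have "statistical_structure A (topspace M) (projective_shift \<omega> \<Gamma>) g"
    using g by (simp add: statistical_structure_def)
  moreover have "projective_shift \<omega> \<Gamma> \<in> P"
    using projective_rel_shift_right[OF openin_topspace _ \<omega>(1)] assms(3) by (simp add: B)
  ultimately show ?thesis by blast
qed

text \<open>The whole manifold serves as the neighbourhood of every point, with the metric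
  \<open>h\<close> that generates the class.\<close>

lemma statistical_imp_locally_statistical:
  assumes G: "conformal_structure A (topspace M) G"
    and "\<forall>g\<in>G. \<exists>\<Gamma>\<in>P. statistical_structure A (topspace M) \<Gamma> g"
  shows "locally_statistical M A P G"
proof -
  obtain h where h: "metric_on A (topspace M) h" "G = conformal_rel A (topspace M) `` {h}"
    using G by (rule conformal_structure_cases)
  note hh = conformal_rel_refl[OF h(1)]
  obtain \<Gamma> where \<Gamma>: "\<Gamma> \<in> P" "statistical_structure A (topspace M) \<Gamma> h"
    using assms(2) hh by (auto simp: h(2))
  then have tf: "torsion_free_connection_on A (topspace M) \<Gamma>"
    by (simp add: statistical_structure_def)
  then have "(\<Gamma>, \<Gamma>) \<in> projective_rel A (topspace M)"
    using oneform_on_zero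
    by (auto simp: projective_rel_def sym2_def intro!: exI[of _ "\<lambda>c p. 0"])
  \<comment> \<open>Restriction to the whole space changes nothing, so these members of
    \<open>P\<close> and \<open>G\<close> are themselves representatives over it.\<close>
  moreover have "restrict_field (topspace M) \<Gamma> = \<Gamma>" "restrict_field (topspace M) h = h"
    using tf h(1) by (auto simp: torsion_free_connection_on_def connection_on_def metric_on_def
        intro!: restrict_field_id)
  ultimately have "\<Gamma> \<in> projective_reps_on A (topspace M) P" "h \<in> conformal_reps_on A (topspace M) G"
    using \<Gamma>(1) hh unfolding projective_reps_on_def conformal_reps_on_def h(2) by force+
  then show ?thesis using \<Gamma>(2) unfolding locally_statistical_def by blast
qed

text \<open>Both \<open>g\<close> and the metric whose restriction is rescaled to \<open>g'\<close>
  are multiples of one \<open>h\<close>, with factors \<open>a\<close> and \<open>b\<close>. If the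
  rescaling is by \<open>f\<close>, the quotient is \<open>f b / a\<close>, smooth on
  \<open>U\<close> because \<open>a\<close> is positive.\<close>

lemma conformal_reps_on_factor:
  assumes G: "conformal_structure A (topspace M) G" and "g \<in> G" "g' \<in> conformal_reps_on A U G"
    and U: "openin M U"
  obtains F where "\<And>c. c \<in> A \<Longrightarrow> smooth_in_chart c U F" "\<And>p. p \<in> U \<Longrightarrow> F p > 0"
    "\<And>c p. c \<in> A \<Longrightarrow> p \<in> U \<inter> fst c \<Longrightarrow> g' c p = F p *\<^sub>R g c p"
proof -
  obtain h where h: "G = conformal_rel A (topspace M) `` {h}"
    using G by (rule conformal_structure_cases)
  obtain g1 where g1: "(h, g1) \<in> conformal_rel A (topspace M)" "(restrict_field U g1, g') \<in> conformal_rel A U"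
    using assms(3) by (auto simp: conformal_reps_on_def h)
  have "(h, g) \<in> conformal_rel A (topspace M)" using assms(2) by (simp add: h)
  then obtain a where a: "smooth_fun A (topspace M) a" "\<And>p. p \<in> topspace M \<Longrightarrow> a p > 0"
      "\<And>c p. c \<in> A \<Longrightarrow> p \<in> topspace M \<inter> fst c \<Longrightarrow> g c p = a p *\<^sub>R h c p"
    unfolding conformal_rel_def by blast
  obtain b where b: "smooth_fun A (topspace M) b" "\<And>p. p \<in> topspace M \<Longrightarrow> b p > 0"
      "\<And>c p. c \<in> A \<Longrightarrow> p \<in> topspace M \<inter> fst c \<Longrightarrow> g1 c p = b p *\<^sub>R h c p"
    using g1(1) unfolding conformal_rel_def by blast
  obtain f where f: "smooth_fun A U f" "\<And>p. p \<in> U \<Longrightarrow> f p > 0"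
      "\<And>c p. c \<in> A \<Longrightarrow> p \<in> U \<inter> fst c \<Longrightarrow> g' c p = f p *\<^sub>R restrict_field U g1 c p"
    using g1(2) unfolding conformal_rel_def by blast
  have UM: "U \<subseteq> topspace M" using U by (rule openin_subset)
  show thesis
  proof
    fix c assume c: "c \<in> A"
    have "smooth_in_chart c U f" using c f(1) by (simp add: smooth_fun_def)
    moreover have "smooth_in_chart c U a" "smooth_in_chart c U b"
      using c a(1) b(1) by (auto simp: smooth_fun_def intro: smooth_in_chart_subset[OF _ UM])
    moreover have "a p \<noteq> 0" if "p \<in> U \<inter> fst c" for p using a(2)[of p] that UM by auto
    ultimately show "smooth_in_chart c U (\<lambda>p. f p * (b p * inverse (a p)))"
      by (intro smooth_in_chart_mult[OF c U] smooth_in_chart_inverse[OF c U])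
  next
    fix p assume "p \<in> U"
    then show "f p * (b p * inverse (a p)) > 0" using a(2) b(2) f(2) UM by auto
  next
    fix c p assume c: "c \<in> A" and p: "p \<in> U \<inter> fst c"
    then have pM: "p \<in> topspace M \<inter> fst c" using UM by blast
    then have "a p \<noteq> 0" using a(2)[of p] by auto
    then show "g' c p = (f p * (b p * inverse (a p))) *\<^sub>R g c p"
      using p by (simp add: f(3)[OF c p] restrict_field_def a(3)[OF c pM] b(3)[OF c pM])
  qed
qed

text \<open>Only a covector at the single point \<open>p\<close> is extracted; a smooth one-form is
  recovered afterwards from the traces of \<open>nabla g\<close>.\<close>

lemma projective_reps_on_difference:
  assumes P: "projective_structure A (topspace M) P" and "\<Gamma> \<in> P" "\<Gamma>' \<in> projective_reps_on A U P"
    and U: "openin M U" and c: "c \<in> A" and p: "p \<in> U \<inter> fst c"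
  obtains s where "\<And>k i j. \<Gamma>' c p $ k $ i $ j =
    \<Gamma> c p $ k $ i $ j + 2 * sym2 (\<lambda>i j. s $ i * of_bool (j = k)) i j"
proof -
  obtain B where B: "P = projective_rel A (topspace M) `` {B}"
    using P by (rule projective_structure_cases)
  obtain \<Gamma>1 where \<Gamma>1: "(B, \<Gamma>1) \<in> projective_rel A (topspace M)"
      "(restrict_field U \<Gamma>1, \<Gamma>') \<in> projective_rel A U"
    using assms(3) by (auto simp: projective_reps_on_def B)
  have \<Gamma>: "(B, \<Gamma>) \<in> projective_rel A (topspace M)" using assms(2) by (simp add: B)
  have pM: "p \<in> topspace M \<inter> fst c" using openin_subset[OF U] p by blast
  obtain a where a: "\<And>k i j. \<Gamma> c p $ k $ i $ j =
      B c p $ k $ i $ j + 2 * sym2 (\<lambda>i j. a c p $ i * of_bool (j = k)) i j"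
    using \<Gamma> c pM unfolding projective_rel_def by blast
  obtain b where b: "\<And>k i j. \<Gamma>1 c p $ k $ i $ j =
      B c p $ k $ i $ j + 2 * sym2 (\<lambda>i j. b c p $ i * of_bool (j = k)) i j"
    using \<Gamma>1(1) c pM unfolding projective_rel_def by blast
  obtain f where f: "\<And>k i j. \<Gamma>' c p $ k $ i $ j =
      restrict_field U \<Gamma>1 c p $ k $ i $ j + 2 * sym2 (\<lambda>i j. f c p $ i * of_bool (j = k)) i j"
    using \<Gamma>1(2) c p unfolding projective_rel_def by blast
  \<comment> \<open>The change from \<open>B\<close> to \<open>\<Gamma>\<close> is by
    \<open>a\<close>, from \<open>B\<close> to \<open>\<Gamma>1\<close> by \<open>b\<close>, and
    from the restriction of \<open>\<Gamma>1\<close> to \<open>\<Gamma>'\<close> by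
    \<open>f\<close>.\<close>
  show thesis
    by (rule that[of "f c p + b c p - a c p"])
      (use p in \<open>simp add: f restrict_field_def a b sym2_def field_simps\<close>)
qed

text \<open>The covector found at a point depends a priori on the neighbourhood and on the local
  representatives. Alignment identifies it with a trace of \<open>nabla g\<close>, which is defined
  globally.\<close>

lemma locally_statistical_imp_AH:
  assumes n: "CARD('n) \<ge> 2"
    and P: "projective_structure A (topspace M) P" and G: "conformal_structure A (topspace M) G"
    and \<Gamma>: "\<Gamma> \<in> P" "aligned A (topspace M) \<Gamma> G"
    and loc: "locally_statistical M A P G"
  shows "AH_structure A (topspace M) \<Gamma> G"
  unfolding AH_structure_def
proof (intro conjI ballI)
  show "aligned A (topspace M) \<Gamma> G" by fact
  obtain B where "P = projective_rel A (topspace M) `` {B}"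
    using P by (rule projective_structure_cases)
  then show tf: "torsion_free_connection_on A (topspace M) \<Gamma>"
    using \<Gamma>(1) by (auto simp: projective_rel_def)
  then have con: "connection_on A (topspace M) \<Gamma>" by (simp add: torsion_free_connection_on_def)
  fix g assume gG: "g \<in> G"
  obtain h where "G = conformal_rel A (topspace M) `` {h}"
    using G by (rule conformal_structure_cases)
  then have g: "metric_on A (topspace M) g" using gG by (auto simp: conformal_rel_def)
  \<comment> \<open>By alignment this equals \<open>trace_first2\<close>; the coefficient
    \<open>0\<close> fits the expression to \<open>oneform_on_traces\<close>.\<close>
  define \<omega> where "\<omega> = (\<lambda>c p. if c \<in> A \<and> p \<in> topspace M \<inter> fst c
     then \<chi> i. 1 / real CARD('n) * trace_last2 \<Gamma> g c p i + 0 * trace_first2 \<Gamma> g c p i else 0)"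
  have "oneform_on A (topspace M) \<omega>"
    unfolding \<omega>_def by (rule oneform_on_traces[OF openin_topspace con g])
  moreover have "alt2 (\<lambda>i j. cov_deriv \<Gamma> g c p i j k) i j = alt2 (\<lambda>i j. \<omega> c p $ i * g c p $ j $ k) i j"
    if c: "c \<in> A" and p: "p \<in> topspace M \<inter> fst c" for c p i j k
  proof -
    obtain U \<Gamma>' g' where U: "openin M U" "p \<in> U" and rep: "\<Gamma>' \<in> projective_reps_on A U P"
        "g' \<in> conformal_reps_on A U G" and stat: "statistical_structure A U \<Gamma>' g'"
      using loc p unfolding locally_statistical_def by blast
    have pU: "p \<in> U \<inter> fst c" using U(2) p by blast
    obtain F where F: "smooth_in_chart c U F" "F p > 0"
        "\<And>q. q \<in> U \<inter> fst c \<Longrightarrow> g' c q = F q *\<^sub>R g c q"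
      using conformal_reps_on_factor[OF G gG rep(2) U(1)] c U(2) by metis
    obtain s where s: "\<And>k i j. \<Gamma>' c p $ k $ i $ j =
        \<Gamma> c p $ k $ i $ j + 2 * sym2 (\<lambda>i j. s $ i * of_bool (j = k)) i j"
      using projective_reps_on_difference[OF P \<Gamma>(1) rep(1) U(1) c pU] by blast
    have g': "metric_on A U g'" using stat by (simp add: statistical_structure_def)
    \<comment> \<open>Vanishing of the alternation for \<open>\<Gamma>'\<close> and
      \<open>F g\<close> at \<open>p\<close> reads
      \<open>F nabla_[i g_j]k + dF_[i g_j]k = F s_[i g_j]k\<close>; division by \<open>F\<close>
      produces this covector.\<close>
    define v where "v i = s $ i - coord_deriv c i F p / F p" for i
    have dF: "diff_in_chart c F p" by (rule smooth_in_chart_imp_diff[OF F(1) pU])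
    have dg: "diff_in_chart c (\<lambda>q. g c q $ j $ k) p" for j k
      by (rule smooth_in_chart_imp_diff[OF metric_on_smooth[OF g c] p])
    have dv: "coord_deriv c i F p = F p * (s $ i - v i)" for i using F(2) by (simp add: v_def)
    have e: "cov_deriv \<Gamma> g' c p i j k =
        F p * cov_deriv \<Gamma> g c p i j k + coord_deriv c i F p * g c p $ j $ k" for i j k
      using c U(1) pU F(3) dF dg by (rule cov_deriv_conformal)
    have v: "alt2 (\<lambda>i j. cov_deriv \<Gamma> g c p i j k) i j = alt2 (\<lambda>i j. v i * g c p $ j $ k) i j" for i j k
    proof -
      have "alt2 (\<lambda>i j. cov_deriv \<Gamma>' g' c p i j k) i j = 0"
        using stat c pU unfolding statistical_structure_def by blast
      then have "alt2 (\<lambda>i j. cov_deriv \<Gamma> g' c p i j k) i j = alt2 (\<lambda>i j. s $ i * g' c p $ j $ k) i j"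
        using alt2_cov_deriv_projective_change[of \<Gamma>' c p \<Gamma> s g', OF s metric_on_pointwise(3)[OF g' c pU], of k i j]
        by simp
      then have "F p * (cov_deriv \<Gamma> g c p i j k - cov_deriv \<Gamma> g c p j i k) =
          F p * (v i * g c p $ j $ k - v j * g c p $ i $ k)"
        by (simp add: alt2_def e dv F(3)[OF pU] field_simps)
      then show ?thesis using F(2) by (simp add: alt2_def)
    qed
    have "\<omega> c p $ i = v i" for i
    proof -
      have "trace_last2 \<Gamma> g c p i = real CARD('n) * trace_first2 \<Gamma> g c p i"
        using \<Gamma>(2) gG c p unfolding aligned_iff_trace by blast
      moreover have "trace_last2 \<Gamma> g c p i - trace_first2 \<Gamma> g c p i = (real CARD('n) - 1) * v i"
        by (rule alt2_cov_deriv_trace[OF openin_topspace g c p v])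
      \<comment> \<open>Alignment turns \<open>trace_last2\<close> into
        \<open>n trace_first2\<close>, so both sides carry the factor \<open>n - 1\<close>, which is
        nonzero for \<open>n >= 2\<close>.\<close>
      ultimately have "(real CARD('n) - 1) * trace_first2 \<Gamma> g c p i = (real CARD('n) - 1) * v i"
        by (simp add: algebra_simps)
      then have "trace_first2 \<Gamma> g c p i = v i" using n by simp
      then show ?thesis
        using c p \<open>trace_last2 \<Gamma> g c p i = _\<close> by (simp add: \<omega>_def)
    qed
    then show ?thesis using v[of k i j] by simp
  qed
  ultimately show "\<exists>\<omega>. oneform_on A (topspace M) \<omega> \<and> (\<forall>c\<in>A. \<forall>p\<in>topspace M \<inter> fst c. \<forall>i j k.
        alt2 (\<lambda>i j. cov_deriv \<Gamma> g c p i j k) i j = alt2 (\<lambda>i j. \<omega> c p $ i * g c p $ j $ k) i j)"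
    by blast
qed

end

theorem lemma9p4:
  fixes M :: "'a topology"
    and A :: "('a, 'n::finite) chart set"
    and P :: "('a, 'n) connection set"
    and G :: "('a, 'n) metric set"
  assumes "CARD('n) \<ge> 2"
    and "smooth_manifold M A"
    and "projective_structure A (topspace M) P"
    and "conformal_structure A (topspace M) G"
  shows "(locally_statistical M A P G \<longleftrightarrow>
            AH_structure A (topspace M) (aligned_representative A (topspace M) P G) G) \<and>
         (AH_structure A (topspace M) (aligned_representative A (topspace M) P G) G \<longleftrightarrow>
            (\<forall>g\<in>G. \<exists>\<Gamma>\<in>P. statistical_structure A (topspace M) \<Gamma> g))"
proof -
  interpret smooth_mfd M A using assms(2) by unfold_locales
  let ?\<Gamma> = "aligned_representative A (topspace M) P G"
  \<comment> \<open>Existence and uniqueness make the definite description denote an aligned member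
    of \<open>P\<close>.\<close>
  have \<Gamma>: "?\<Gamma> \<in> P" "aligned A (topspace M) ?\<Gamma> G"
    using theI'[OF ex1_aligned_representative[OF assms(1) openin_topspace assms(3,4)]]
    unfolding aligned_representative_def by blast+
  \<comment> \<open>The implications close a cycle: locally statistical, then AH, then statistical
    for every metric, then locally statistical again.\<close>
  show ?thesis
    using locally_statistical_imp_AH[OF assms(1,3,4) \<Gamma>] AH_imp_statistical[OF assms(3,4) \<Gamma>(1)]
      statistical_imp_locally_statistical[OF assms(4)] by blast
qed

end
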